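(* Let $(I,J,K)$ be an almost hypercomplex structure on a Courant algebroid $(E,\rho,\langle\cdot,\cdot\rangle,\circ)$. The following assertions are equivalent: (1) $\mathcal{N}(I,J)=0$; (2) $\mathcal{N}(I,I)=\mathcal{N}(J,J)=0$; (3) $(I,J,K)$ is a hypercomplex structure, i.e. all six of $\mathcal{N}(I,I)$, $\mathcal{N}(I,J)$, $\mathcal{N}(I,K)$, $\mathcal{N}(J,J)$, $\mathcal{N}(J,K)$, $\mathcal{N}(K,K)$ vanish; (4) there exists a unique hypercomplex connection $\nabla$ on $E$ that satisfies $\nabla I=\nabla J=\nabla K=0$ and, for all $U,V\in\Gamma(E)$, $$T^{\nabla}(U,V)=I\mathcal{D}\langle U,IV\rangle+J\mathcal{D}\langle U,JV\rangle+K\mathcal{D}\langle U,KV\rangle .$$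
   Context: A Courant algebroid $(E,\rho,\langle\cdot,\cdot\rangle,\circ)$ over a smooth manifold $M$ is a real vector bundle $E\to M$ with a nondegenerate symmetric pairing $\langle\cdot,\cdot\rangle$ on the fibres, a bundle map $\rho:E\to TM$ (anchor) and an $\mathbb{R}$-bilinear operation $\circ$ on $\Gamma(E)$ (Dorfman bracket) such that for all $f\in C^\infty(M)$, $x,y,z\in\Gamma(E)$: $x\circ(y\circ z)=(x\circ y)\circ z+y\circ(x\circ z)$; $\rho(x\circ y)=[\rho(x),\rho(y)]$; $x\circ fy=(\rho(x)f)y+f(x\circ y)$; $x\circ y+y\circ x=2\mathcal{D}\langle x,y\rangle$; $\mathcal{D}f\circ x=0$; $\rho(x)\langle y,z\rangle=\langle x\circ y,z\rangle+\langle y,x\circ z\rangle$; where $\mathcal{D}:C^\infty(M)\to\Gamma(E)$ is defined by $\langle\mathcal{D}f,x\rangle=\frac12\rho(x)f$. For endomorphisms $F,G$ of the vector bundle $E$ (over $\mathrm{id}_M$), the Nijenhuis concomitant is $\mathcal{N}(F,G)(U,V)=FU\circ GV-F(U\circ GV)-G(FU\circ V)+FG(U\circ V)+GU\circ FV-G(U\circ FV)-F(GU\circ V)+GF(U\circ V)$, $U,V\in\Gamma(E)$. An almost complex structure on $E$ is a vector bundle endomorphism $J$ of $E$ orthogonal for $\langle\cdot,\cdot\rangle$ with $J^2=-1$. An almost hypercomplex structure on $E$ is a triple $(I,J,K)$ of almost complex structures with $I^2=J^2=K^2=IJK=-1$. Given an almost hypercomplex structure, put $\triangle_f(U,V)=\langle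 U,V\rangle\mathcal{D}f+\langle IU,V\rangle I\mathcal{D}f+\langle JU,V\rangle J\mathcal{D}f+\langle KU,V\rangle K\mathcal{D}f$. A hypercomplex connection is an $\mathbb{R}$-bilinear map $\Gamma(E)\times\Gamma(E)\to\Gamma(E)$, $(U,V)\mapsto\nabla_UV$, with $\nabla_{fU}V=f\nabla_UV$ and $\nabla_U(fV)=(\rho(U)f)V+f\nabla_UV-\triangle_f(U,V)$ for all $f\in C^\infty(M)$, $U,V\in\Gamma(E)$. Its torsion is $T^\nabla(U,V)=\nabla_UV-\nabla_VU-\frac12(U\circ V-V\circ U)$. $\nabla I=0$ means $\nabla_U(IV)=I\nabla_UV$ for all $U,V$, and similarly for $J,K$. *)

theory Defs
  imports "HOL-Analysis.Analysis" "HOL-Library.Function_Algebras"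
begin

section \<open>Smooth functions on open subsets of \<open>\<real>\<^sup>n\<close>\<close>

text \<open>
  As in the library constant \<^const>\<open>Euclidean_space\<close>, \<open>\<real>\<^sup>n\<close> is the set of those
  \<open>x :: nat \<Rightarrow> real\<close> with \<open>x i = 0\<close> for \<open>i \<ge> n\<close>. This allows dimension (and, below, rank) \<open>0\<close>.
\<close>

definition partial_deriv :: "nat \<Rightarrow> ((nat \<Rightarrow> real) \<Rightarrow> real) \<Rightarrow> (nat \<Rightarrow> real) \<Rightarrow> real" where
  "partial_deriv i f x = deriv (\<lambda>t. f (x(i := t))) (x i)"

primrec Ck_on :: "nat \<Rightarrow> nat \<Rightarrow> (nat \<Rightarrow> real) set \<Rightarrow> ((nat \<Rightarrow> real) \<Rightarrow> real) \<Rightarrow> bool" where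
  "Ck_on n 0 W f \<longleftrightarrow> continuous_on W f"
| "Ck_on n (Suc k) W f \<longleftrightarrow> continuous_on W f \<and>
     (\<forall>i<n. (\<forall>x\<in>W. (\<lambda>t. f (x(i := t))) differentiable at (x i)) \<and> Ck_on n k W (partial_deriv i f))"

definition smooth_on_Rn :: "nat \<Rightarrow> (nat \<Rightarrow> real) set \<Rightarrow> ((nat \<Rightarrow> real) \<Rightarrow> real) \<Rightarrow> bool" where
  "smooth_on_Rn n W f \<longleftrightarrow> (\<forall>k. Ck_on n k W f)"


section \<open>Smooth manifolds\<close>

text \<open>
  The points of the manifold are the elements of the type \<open>'m\<close>, with its type-class topology;
  \<open>charts\<close> is a smooth atlas of pairs (chart domain, chart map). A chart map is only relevant on
  its domain.
\<close>

record 'm manifold_data =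
  mdim :: nat
  charts :: "('m set \<times> ('m \<Rightarrow> nat \<Rightarrow> real)) set"

definition smooth_manifold ::
    "('m::{t2_space,second_countable_topology}, 'z) manifold_data_scheme \<Rightarrow> bool" where
  "smooth_manifold M \<longleftrightarrow>
     (\<Union>(U, \<phi>)\<in>charts M. U) = UNIV \<and>
     (\<forall>(U, \<phi>)\<in>charts M. open U \<and> openin (Euclidean_space (mdim M)) (\<phi> ` U) \<and>
        homeomorphism U (\<phi> ` U) \<phi> (inv_into U \<phi>)) \<and>
     (\<forall>(U, \<phi>)\<in>charts M. \<forall>(V, \<psi>)\<in>charts M. \<forall>i<mdim M.
        smooth_on_Rn (mdim M) (\<phi> ` (U \<inter> V)) (\<lambda>x. \<psi> (inv_into U \<phi> x) i))"

definition smooth_fun_on :: "('m, 'z) manifold_data_scheme \<Rightarrow> 'm set \<Rightarrow> ('m \<Rightarrow> real) \<Rightarrow> bool" where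
  "smooth_fun_on M W f \<longleftrightarrow>
     (\<forall>(U, \<phi>)\<in>charts M. smooth_on_Rn (mdim M) (\<phi> ` (U \<inter> W)) (\<lambda>x. f (inv_into U \<phi> x)))"

definition Cinf :: "('m, 'z) manifold_data_scheme \<Rightarrow> ('m \<Rightarrow> real) set" where
  "Cinf M = {f. smooth_fun_on M UNIV f}"

text \<open>
  Tangent vectors at \<open>p\<close> are derivations at \<open>p\<close> of the algebra \<open>C\<^sup>\<infinity>(M)\<close>. The products and sums of
  functions below are the pointwise ones. Values on non-smooth functions are irrelevant.
\<close>

definition tangent_vector ::
    "('m, 'z) manifold_data_scheme \<Rightarrow> 'm \<Rightarrow> (('m \<Rightarrow> real) \<Rightarrow> real) \<Rightarrow> bool" where
  "tangent_vector M p X \<longleftrightarrow>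
     (\<forall>f\<in>Cinf M. \<forall>g\<in>Cinf M. X (f + g) = X f + X g \<and> X (f * g) = f p * X g + g p * X f) \<and>
     (\<forall>f\<in>Cinf M. \<forall>c. X (\<lambda>q. c * f q) = c * X f)"


section \<open>Vector bundles\<close>

definition fibre_linear :: "'v::real_vector set \<Rightarrow> ('v \<Rightarrow> 'w::real_vector) \<Rightarrow> bool" where
  "fibre_linear S h \<longleftrightarrow>
     (\<forall>u\<in>S. \<forall>v\<in>S. h (u + v) = h u + h v) \<and> (\<forall>c. \<forall>u\<in>S. h (c *\<^sub>R u) = c *\<^sub>R h u)"

text \<open>
  The fibre over \<open>p\<close> is the vector space \<open>fibre E p\<close>, realised as a subspace of some real vector
  space \<open>'v\<close>. The latter is only a common type for the fibres: it has no topology, may be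
  infinite-dimensional, and is unrelated to the bundle structure, which is given by the local
  trivialisations \<open>(W, \<Phi>)\<close>: for \<open>p \<in> W\<close>, \<open>\<Phi> p\<close> is a linear isomorphism from the fibre over \<open>p\<close> to
  \<open>\<real>\<^sup>r\<close>. The total space is the disjoint union of the fibres, with the unique smooth structure for
  which the trivialisations are diffeomorphisms.
\<close>

record ('m, 'v) bundle_data = "'m manifold_data" +
  rank :: nat
  fibre :: "'m \<Rightarrow> 'v set"
  trivs :: "('m set \<times> ('m \<Rightarrow> 'v \<Rightarrow> nat \<Rightarrow> real)) set"

definition frame ::
    "('m, 'v, 'z) bundle_data_scheme \<Rightarrow> ('m \<Rightarrow> 'v \<Rightarrow> nat \<Rightarrow> real) \<Rightarrow> nat \<Rightarrow> 'm \<Rightarrow> 'v" where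
  "frame E \<Phi> j p = inv_into (fibre E p) (\<Phi> p) (\<lambda>k. if k = j then 1 else 0)"

definition vector_bundle ::
    "('m::{t2_space,second_countable_topology}, 'v::real_vector, 'z) bundle_data_scheme \<Rightarrow> bool" where
  "vector_bundle E \<longleftrightarrow>
     smooth_manifold E \<and>
     (\<forall>p. subspace (fibre E p)) \<and>
     (\<Union>(W, \<Phi>)\<in>trivs E. W) = UNIV \<and>
     (\<forall>(W, \<Phi>)\<in>trivs E. open W \<and>
        (\<forall>p\<in>W. bij_betw (\<Phi> p) (fibre E p) (topspace (Euclidean_space (rank E))) \<and>
                (\<forall>i. fibre_linear (fibre E p) (\<lambda>v. \<Phi> p v i)))) \<and>
     (\<forall>(W, \<Phi>)\<in>trivs E. \<forall>(W', \<Phi>')\<in>trivs E. \<forall>i<rank E. \<forall>j<rank E.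
        smooth_fun_on E (W \<inter> W') (\<lambda>p. \<Phi>' p (frame E \<Phi> j p) i))"

definition sections :: "('m, 'v, 'z) bundle_data_scheme \<Rightarrow> ('m \<Rightarrow> 'v) set" where
  "sections E = {s. (\<forall>p. s p \<in> fibre E p) \<and>
     (\<forall>(W, \<Phi>)\<in>trivs E. \<forall>i<rank E. smooth_fun_on E W (\<lambda>p. \<Phi> p (s p) i))}"

definition fscale :: "('m \<Rightarrow> real) \<Rightarrow> ('m \<Rightarrow> 'v::real_vector) \<Rightarrow> 'm \<Rightarrow> 'v"  (infixr "\<star>" 75) where
  "f \<star> U = (\<lambda>p. f p *\<^sub>R U p)"

definition bundle_endo ::
    "('m, 'v::real_vector, 'z) bundle_data_scheme \<Rightarrow> ('m \<Rightarrow> 'v \<Rightarrow> 'v) \<Rightarrow> bool" where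
  "bundle_endo E F \<longleftrightarrow>
     (\<forall>p. F p ` fibre E p \<subseteq> fibre E p \<and> fibre_linear (fibre E p) (F p)) \<and>
     (\<forall>(W, \<Phi>)\<in>trivs E. \<forall>i<rank E. \<forall>j<rank E. smooth_fun_on E W (\<lambda>p. \<Phi> p (F p (frame E \<Phi> j p)) i))"

definition endo_app :: "('m \<Rightarrow> 'v \<Rightarrow> 'v) \<Rightarrow> ('m \<Rightarrow> 'v) \<Rightarrow> 'm \<Rightarrow> 'v"  (infixr "\<cdot>" 80) where
  "F \<cdot> U = (\<lambda>p. F p (U p))"


section \<open>Courant algebroids\<close>

record ('m, 'v) courant_data = "('m, 'v) bundle_data" +
  pairing :: "'m \<Rightarrow> 'v \<Rightarrow> 'v \<Rightarrow> real"
  anchor :: "'m \<Rightarrow> 'v \<Rightarrow> ('m \<Rightarrow> real) \<Rightarrow> real"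
  dorfman :: "('m \<Rightarrow> 'v) \<Rightarrow> ('m \<Rightarrow> 'v) \<Rightarrow> 'm \<Rightarrow> 'v"

definition bundle_pairing ::
    "('m, 'v::real_vector, 'z) bundle_data_scheme \<Rightarrow> ('m \<Rightarrow> 'v \<Rightarrow> 'v \<Rightarrow> real) \<Rightarrow> bool" where
  "bundle_pairing E g \<longleftrightarrow>
     (\<forall>p. \<forall>u\<in>fibre E p. \<forall>v\<in>fibre E p. g p u v = g p v u) \<and>
     (\<forall>p. \<forall>u\<in>fibre E p. fibre_linear (fibre E p) (g p u)) \<and>
     (\<forall>p. \<forall>u\<in>fibre E p. (\<forall>v\<in>fibre E p. g p u v = 0) \<longrightarrow> u = 0) \<and>
     (\<forall>(W, \<Phi>)\<in>trivs E. \<forall>i<rank E. \<forall>j<rank E.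
        smooth_fun_on E W (\<lambda>p. g p (frame E \<Phi> i p) (frame E \<Phi> j p)))"

text \<open>
  A bundle map to the tangent bundle: fibrewise linear, and it sends local frames to smooth local
  vector fields, i.e. to families of tangent vectors \<open>X\<close> such that \<open>p \<mapsto> X p f\<close> is smooth for all
  \<open>f \<in> C\<^sup>\<infinity>(M)\<close>.
\<close>

definition bundle_anchor ::
    "('m, 'v::real_vector, 'z) bundle_data_scheme \<Rightarrow> ('m \<Rightarrow> 'v \<Rightarrow> ('m \<Rightarrow> real) \<Rightarrow> real) \<Rightarrow> bool" where
  "bundle_anchor E \<rho> \<longleftrightarrow>
     (\<forall>p. \<forall>v\<in>fibre E p. tangent_vector E p (\<rho> p v)) \<and>
     (\<forall>p. \<forall>f\<in>Cinf E. fibre_linear (fibre E p) (\<lambda>v. \<rho> p v f)) \<and>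
     (\<forall>(W, \<Phi>)\<in>trivs E. \<forall>j<rank E. \<forall>f\<in>Cinf E. smooth_fun_on E W (\<lambda>p. \<rho> p (frame E \<Phi> j p) f))"

definition pair :: "('m, 'v, 'z) courant_data_scheme \<Rightarrow> ('m \<Rightarrow> 'v) \<Rightarrow> ('m \<Rightarrow> 'v) \<Rightarrow> 'm \<Rightarrow> real" where
  "pair E U V = (\<lambda>p. pairing E p (U p) (V p))"

definition lie :: "('m, 'v, 'z) courant_data_scheme \<Rightarrow> ('m \<Rightarrow> 'v) \<Rightarrow> ('m \<Rightarrow> real) \<Rightarrow> 'm \<Rightarrow> real" where
  "lie E U f = (\<lambda>p. anchor E p (U p) f)"

text \<open>
  The value of \<open>\<D> f\<close> at \<open>p\<close>: the element of the fibre representing \<open>w \<mapsto> \<rho>(w) f / 2\<close>. It exists and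
  is unique because the pairing is nondegenerate on the finite-dimensional fibre.
\<close>

definition calD :: "('m, 'v, 'z) courant_data_scheme \<Rightarrow> ('m \<Rightarrow> real) \<Rightarrow> 'm \<Rightarrow> 'v" where
  "calD E f p = (THE v. v \<in> fibre E p \<and> (\<forall>w\<in>fibre E p. pairing E p v w = anchor E p w f / 2))"

definition bilinear_on_sections ::
    "('m, 'v::real_vector, 'z) bundle_data_scheme \<Rightarrow>
      (('m \<Rightarrow> 'v) \<Rightarrow> ('m \<Rightarrow> 'v) \<Rightarrow> 'm \<Rightarrow> 'v) \<Rightarrow> bool" where
  "bilinear_on_sections E B \<longleftrightarrow>
     (\<forall>x\<in>sections E. \<forall>y\<in>sections E. B x y \<in> sections E) \<and>
     (\<forall>x\<in>sections E. \<forall>y\<in>sections E. \<forall>z\<in>sections E.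
        B (x + y) z = B x z + B y z \<and> B x (y + z) = B x y + B x z) \<and>
     (\<forall>c. \<forall>x\<in>sections E. \<forall>y\<in>sections E.
        B ((\<lambda>p. c) \<star> x) y = (\<lambda>p. c) \<star> B x y \<and> B x ((\<lambda>p. c) \<star> y) = (\<lambda>p. c) \<star> B x y)"

definition courant_algebroid ::
    "('m::{t2_space,second_countable_topology}, 'v::real_vector, 'z) courant_data_scheme \<Rightarrow> bool" where
  "courant_algebroid E \<longleftrightarrow>
     vector_bundle E \<and> bundle_pairing E (pairing E) \<and> bundle_anchor E (anchor E) \<and>
     bilinear_on_sections E (dorfman E) \<and>
     (\<forall>x\<in>sections E. \<forall>y\<in>sections E. \<forall>z\<in>sections E.
        dorfman E x (dorfman E y z) = dorfman E (dorfman E x y) z + dorfman E y (dorfman E x z)) \<and>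
     (\<forall>x\<in>sections E. \<forall>y\<in>sections E. \<forall>f\<in>Cinf E.
        lie E (dorfman E x y) f = lie E x (lie E y f) - lie E y (lie E x f)) \<and>
     (\<forall>x\<in>sections E. \<forall>y\<in>sections E. \<forall>f\<in>Cinf E.
        dorfman E x (f \<star> y) = lie E x f \<star> y + f \<star> dorfman E x y) \<and>
     (\<forall>x\<in>sections E. \<forall>y\<in>sections E.
        dorfman E x y + dorfman E y x = (\<lambda>p. 2) \<star> calD E (pair E x y)) \<and>
     (\<forall>x\<in>sections E. \<forall>f\<in>Cinf E. dorfman E (calD E f) x = 0) \<and>
     (\<forall>x\<in>sections E. \<forall>y\<in>sections E. \<forall>z\<in>sections E.
        lie E x (pair E y z) = pair E (dorfman E x y) z + pair E y (dorfman E x z))"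


section \<open>Hypercomplex structures\<close>

definition nijenhuis ::
    "('m, 'v::real_vector, 'z) courant_data_scheme \<Rightarrow> ('m \<Rightarrow> 'v \<Rightarrow> 'v) \<Rightarrow> ('m \<Rightarrow> 'v \<Rightarrow> 'v) \<Rightarrow>
      ('m \<Rightarrow> 'v) \<Rightarrow> ('m \<Rightarrow> 'v) \<Rightarrow> 'm \<Rightarrow> 'v" where
  "nijenhuis E F G U V =
     dorfman E (F \<cdot> U) (G \<cdot> V) - F \<cdot> dorfman E U (G \<cdot> V) - G \<cdot> dorfman E (F \<cdot> U) V
       + F \<cdot> G \<cdot> dorfman E U V
     + dorfman E (G \<cdot> U) (F \<cdot> V) - G \<cdot> dorfman E U (F \<cdot> V) - F \<cdot> dorfman E (G \<cdot> U) V
       + G \<cdot> F \<cdot> dorfman E U V"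

definition nijenhuis_zero ::
    "('m, 'v::real_vector, 'z) courant_data_scheme \<Rightarrow> ('m \<Rightarrow> 'v \<Rightarrow> 'v) \<Rightarrow> ('m \<Rightarrow> 'v \<Rightarrow> 'v) \<Rightarrow> bool" where
  "nijenhuis_zero E F G \<longleftrightarrow> (\<forall>U\<in>sections E. \<forall>V\<in>sections E. nijenhuis E F G U V = 0)"

definition almost_complex ::
    "('m, 'v::real_vector, 'z) courant_data_scheme \<Rightarrow> ('m \<Rightarrow> 'v \<Rightarrow> 'v) \<Rightarrow> bool" where
  "almost_complex E J \<longleftrightarrow>
     bundle_endo E J \<and>
     (\<forall>p. \<forall>u\<in>fibre E p. \<forall>v\<in>fibre E p. pairing E p (J p u) (J p v) = pairing E p u v) \<and>
     (\<forall>p. \<forall>u\<in>fibre E p. J p (J p u) = - u)"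

definition almost_hypercomplex ::
    "('m, 'v::real_vector, 'z) courant_data_scheme \<Rightarrow>
      ('m \<Rightarrow> 'v \<Rightarrow> 'v) \<Rightarrow> ('m \<Rightarrow> 'v \<Rightarrow> 'v) \<Rightarrow> ('m \<Rightarrow> 'v \<Rightarrow> 'v) \<Rightarrow> bool" where
  "almost_hypercomplex E I J K \<longleftrightarrow>
     almost_complex E I \<and> almost_complex E J \<and> almost_complex E K \<and>
     (\<forall>p. \<forall>u\<in>fibre E p. I p (J p (K p u)) = - u)"

definition hypercomplex ::
    "('m, 'v::real_vector, 'z) courant_data_scheme \<Rightarrow>
      ('m \<Rightarrow> 'v \<Rightarrow> 'v) \<Rightarrow> ('m \<Rightarrow> 'v \<Rightarrow> 'v) \<Rightarrow> ('m \<Rightarrow> 'v \<Rightarrow> 'v) \<Rightarrow> bool" where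
  "hypercomplex E I J K \<longleftrightarrow>
     almost_hypercomplex E I J K \<and>
     nijenhuis_zero E I I \<and> nijenhuis_zero E I J \<and> nijenhuis_zero E I K \<and>
     nijenhuis_zero E J J \<and> nijenhuis_zero E J K \<and> nijenhuis_zero E K K"

definition triangle ::
    "('m, 'v::real_vector, 'z) courant_data_scheme \<Rightarrow>
      ('m \<Rightarrow> 'v \<Rightarrow> 'v) \<Rightarrow> ('m \<Rightarrow> 'v \<Rightarrow> 'v) \<Rightarrow> ('m \<Rightarrow> 'v \<Rightarrow> 'v) \<Rightarrow>
      ('m \<Rightarrow> real) \<Rightarrow> ('m \<Rightarrow> 'v) \<Rightarrow> ('m \<Rightarrow> 'v) \<Rightarrow> 'm \<Rightarrow> 'v" where
  "triangle E I J K f U V =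
     pair E U V \<star> calD E f + pair E (I \<cdot> U) V \<star> I \<cdot> calD E f
     + pair E (J \<cdot> U) V \<star> J \<cdot> calD E f + pair E (K \<cdot> U) V \<star> K \<cdot> calD E f"

text \<open>
  A connection is a map defined on pairs of sections; extensionality (\<open>\<rightarrow>\<^sub>E\<close>) fixes the irrelevant
  values of the HOL function elsewhere, so that uniqueness can be expressed by \<open>\<exists>!\<close>.
\<close>

definition hypercomplex_connection ::
    "('m, 'v::real_vector, 'z) courant_data_scheme \<Rightarrow>
      ('m \<Rightarrow> 'v \<Rightarrow> 'v) \<Rightarrow> ('m \<Rightarrow> 'v \<Rightarrow> 'v) \<Rightarrow> ('m \<Rightarrow> 'v \<Rightarrow> 'v) \<Rightarrow>
      (('m \<Rightarrow> 'v) \<Rightarrow> ('m \<Rightarrow> 'v) \<Rightarrow> 'm \<Rightarrow> 'v) \<Rightarrow> bool" where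
  "hypercomplex_connection E I J K D \<longleftrightarrow>
     D \<in> sections E \<rightarrow>\<^sub>E sections E \<rightarrow>\<^sub>E sections E \<and>
     bilinear_on_sections E D \<and>
     (\<forall>f\<in>Cinf E. \<forall>U\<in>sections E. \<forall>V\<in>sections E.
        D (f \<star> U) V = f \<star> D U V \<and>
        D U (f \<star> V) = lie E U f \<star> V + f \<star> D U V - triangle E I J K f U V)"

definition torsion ::
    "('m, 'v::real_vector, 'z) courant_data_scheme \<Rightarrow> (('m \<Rightarrow> 'v) \<Rightarrow> ('m \<Rightarrow> 'v) \<Rightarrow> 'm \<Rightarrow> 'v) \<Rightarrow>
      ('m \<Rightarrow> 'v) \<Rightarrow> ('m \<Rightarrow> 'v) \<Rightarrow> 'm \<Rightarrow> 'v" where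
  "torsion E D U V = D U V - D V U - (\<lambda>p. 1/2) \<star> (dorfman E U V - dorfman E V U)"

definition parallel ::
    "('m, 'v, 'z) courant_data_scheme \<Rightarrow> (('m \<Rightarrow> 'v) \<Rightarrow> ('m \<Rightarrow> 'v) \<Rightarrow> 'm \<Rightarrow> 'v) \<Rightarrow>
      ('m \<Rightarrow> 'v \<Rightarrow> 'v) \<Rightarrow> bool" where
  "parallel E D F \<longleftrightarrow> (\<forall>U\<in>sections E. \<forall>V\<in>sections E. D U (F \<cdot> V) = F \<cdot> D U V)"

end

theory Submission
  imports Defs
begin

text \<open>
  Write \<open>\<Omega>(U, V)\<close> for the sum of \<open>a\<^sup>-\<^sup>1 \<D>\<langle>U, aV\<rangle>\<close> over \<open>a \<in> {1, I, J, K}\<close>, and put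
  \<open>C(U, V) = U \<circ> V - \<Omega>(U, V)\<close>. Because \<open>I\<close>, \<open>J\<close>, \<open>K\<close> are skew for the pairing, the symmetric part of
  \<open>\<Omega>\<close> is \<open>\<D>\<langle>U, V\<rangle>\<close>, which is that of \<open>\<circ>\<close>; so \<open>C\<close> is skew-symmetric. Reindexing the sum shows that
  \<open>\<Omega>\<close> commutes with \<open>I\<close>, \<open>J\<close>, \<open>K\<close> in its second argument, and every such map has vanishing
  concomitants. Hence \<open>\<circ>\<close> and \<open>C\<close> have the same concomitants, and the prescribed torsion says
  exactly that \<open>\<nabla>\<^sub>U V - \<nabla>\<^sub>V U = C(U, V)\<close>.

  What remains is the classical theory of the Obata connection for the skew biadditive map \<open>C\<close>. Call
  \<open>B(U, V) - B(V, U)\<close> the alternation of a map \<open>B\<close>. A \<open>\<nabla>\<close> that commutes with \<open>I\<close> and \<open>J\<close> in its second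
  argument and has alternation \<open>C\<close> must satisfy
  \<open>2\<nabla>\<^sub>U V = C(U, V) + K C(IU, JV) + I C(IU, V) - J C(U, JV)\<close>. Conversely let \<open>W(U, V)\<close> be this right-hand
  side. It always commutes with \<open>J\<close> in \<open>V\<close>; it commutes with \<open>I\<close> if \<open>\<N>(I, I) = 0\<close>; and
  \<open>W(U, V) - W(V, U) = 2 C(U, V) + K \<N>(I, J)(U, V)\<close> (\<open>obata_J\<close>, \<open>obata_I\<close>, \<open>obata_torsion\<close>).

  The alternation of a map commuting with \<open>F\<close> and \<open>G\<close> in the second argument has \<open>\<N>(F, G) = 0\<close>
  (\<open>nij_zero_of_equivariant\<close>). Applied to \<open>W\<close>, this gives \<open>\<N>(J, J) = 0\<close> from \<open>\<N>(I, J) = 0\<close>,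
  also \<open>\<N>(I, I) = 0\<close> by exchanging \<open>I\<close> and \<open>J\<close>, and then, as \<open>W\<close> now commutes with all of \<open>I\<close>, \<open>J\<close>, \<open>K\<close>, the
  vanishing of all six concomitants. Applied to a connection with the required properties, it gives
  \<open>\<N>(I, J) = 0\<close>. If \<open>\<N>(I, I) = \<N>(J, J) = 0\<close>, then \<open>W\<close> and the analogous map for the triple \<open>(J, I, -K)\<close> both commute with
  \<open>I\<close> and \<open>J\<close>; their difference is \<open>K \<N>(I, J)\<close>, which is also skew, hence quaternionic-linear in both
  arguments, hence zero since \<open>IJ = - JI\<close> (\<open>biequivariant_zero\<close>). The same lemma, applied to the symmetric
  difference of two connections, gives uniqueness.

  Finally \<open>C\<close> satisfies the Leibniz rule in its second argument with the correction term \<open>\<triangle>\<close>, and \<open>\<triangle>\<close>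
  is quaternionic-linear in its second argument; in \<open>W\<close> the unwanted terms cancel, so \<open>W / 2\<close> is a
  hypercomplex connection (\<open>hypercomplex_connection_obata\<close>). The remaining work is the calculus behind
  this: sections form a module over smooth functions that is stable under bundle endomorphisms,
  pairings of sections are smooth, and \<open>\<D>f\<close> exists and is a derivation in \<open>f\<close>.
\<close>

section \<open>Skew brackets on modules over the quaternions\<close>

text \<open>
  The Nijenhuis concomitant on an arbitrary additive group. Keeping it free of geometry lets the same
  identities be used for the Dorfman bracket and for its skew-symmetric correction.
\<close>

definition nij :: "('a \<Rightarrow> 'a \<Rightarrow> 'a::ab_group_add) \<Rightarrow> ('a \<Rightarrow> 'a) \<Rightarrow> ('a \<Rightarrow> 'a) \<Rightarrow> 'a \<Rightarrow> 'a \<Rightarrow> 'a" where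
  "nij B F G u v =
     B (F u) (G v) - F (B u (G v)) - G (B (F u) v) + F (G (B u v))
     + B (G u) (F v) - G (B u (F v)) - F (B (G u) v) + G (F (B u v))"

definition nij_zero :: "'a set \<Rightarrow> ('a \<Rightarrow> 'a \<Rightarrow> 'a::ab_group_add) \<Rightarrow> ('a \<Rightarrow> 'a) \<Rightarrow> ('a \<Rightarrow> 'a) \<Rightarrow> bool" where
  "nij_zero S B F G \<longleftrightarrow> (\<forall>u\<in>S. \<forall>v\<in>S. nij B F G u v = 0)"

text \<open>
  A subgroup carrying an action of the quaternions. It is a subset rather than a type because it will
  be instantiated both with the fibres of a bundle and with its sections. The structure is purely
  additive: all identities between concomitants have integer coefficients, up to a division by two
  that the absence of 2-torsion (the last axiom) replaces.
\<close>

locale quaternionic =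
  fixes S :: "'a::ab_group_add set" and I J K :: "'a \<Rightarrow> 'a"
  assumes add_closed [simp]: "\<lbrakk>u \<in> S; v \<in> S\<rbrakk> \<Longrightarrow> u + v \<in> S"
    and minus_closed [simp]: "u \<in> S \<Longrightarrow> - u \<in> S"
    and I_closed [simp]: "u \<in> S \<Longrightarrow> I u \<in> S"
    and J_closed [simp]: "u \<in> S \<Longrightarrow> J u \<in> S"
    and I_add: "\<lbrakk>u \<in> S; v \<in> S\<rbrakk> \<Longrightarrow> I (u + v) = I u + I v"
    and J_add: "\<lbrakk>u \<in> S; v \<in> S\<rbrakk> \<Longrightarrow> J (u + v) = J u + J v"
    and I_I [simp]: "u \<in> S \<Longrightarrow> I (I u) = - u"
    and J_J [simp]: "u \<in> S \<Longrightarrow> J (J u) = - u"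
    and I_J [simp]: "u \<in> S \<Longrightarrow> I (J u) = K u"
    and J_I [simp]: "u \<in> S \<Longrightarrow> J (I u) = - K u"
    and double_zero: "\<lbrakk>u \<in> S; u + u = 0\<rbrakk> \<Longrightarrow> u = 0"
begin

lemma K_closed [simp]: "u \<in> S \<Longrightarrow> K u \<in> S"
  using I_J[of u] I_closed[OF J_closed[of u]] by simp

lemma diff_closed [simp]: "\<lbrakk>u \<in> S; v \<in> S\<rbrakk> \<Longrightarrow> u - v \<in> S"
  using add_closed[of u "- v"] by simp

lemma I_minus: "u \<in> S \<Longrightarrow> I (- u) = - I u"
  using I_add[of u "- u"] I_add[of "u - u" "u - u"] diff_closed[of u u]
  by (simp add: eq_neg_iff_add_eq_0 add.commute)

lemma J_minus: "u \<in> S \<Longrightarrow> J (- u) = - J u"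
  using J_add[of u "- u"] J_add[of "u - u" "u - u"] diff_closed[of u u]
  by (simp add: eq_neg_iff_add_eq_0 add.commute)

lemma K_add: "\<lbrakk>u \<in> S; v \<in> S\<rbrakk> \<Longrightarrow> K (u + v) = K u + K v"
  by (simp add: I_J[symmetric] J_add I_add del: I_J)

lemma K_minus: "u \<in> S \<Longrightarrow> K (- u) = - K u"
  by (simp add: I_J[symmetric] J_minus I_minus del: I_J)

lemma IJK_diff:
  assumes "u \<in> S" "v \<in> S"
  shows "I (u - v) = I u - I v" "J (u - v) = J u - J v" "K (u - v) = K u - K v"
  using I_add[of u "- v"] J_add[of u "- v"] K_add[of u "- v"] assms
  by (simp_all add: I_minus J_minus K_minus)

lemmas linear_simps = I_add J_add K_add I_minus J_minus K_minus IJK_diff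

lemma zero_image:
  assumes "u \<in> S"
  shows "I 0 = 0" "J 0 = 0" "K 0 = 0"
  using IJK_diff[of u u] assms by simp_all

lemma K_products [simp]:
  assumes "u \<in> S"
  shows "I (K u) = - J u" "J (K u) = I u" "K (I u) = J u" "K (J u) = - I u" "K (K u) = - u"
proof -
  show 1: "I (K u) = - J u" using I_I[of "J u"] assms by simp
  show 4: "K (J u) = - I u" using I_J[of "J u"] assms by (simp add: I_minus)
  show 2: "J (K u) = I u" using J_I[of "J u"] assms 4 by simp
  show 3: "K (I u) = J u" using I_J[of "I u"] assms 1 by (simp add: I_minus)
  show "K (K u) = - u" using I_J[of "K u"] assms 2 by simp
qed

text \<open>
  The exchange of \<open>I\<close> and \<open>J\<close> replaces \<open>K = IJ\<close> by \<open>JI = - K\<close>. It turns every statement on \<open>(I, J)\<close> into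
  one on \<open>(J, I)\<close>.
\<close>

lemma swap_quaternionic: "quaternionic S J I (\<lambda>u. - K u)"
  by (unfold_locales; (rule double_zero; assumption)?) (simp_all add: I_add J_add)

text \<open>
  \<open>T (I u) (J v)\<close> can be evaluated in two orders, as \<open>I J T\<close> and as \<open>J I T\<close>; these are opposite.
\<close>

lemma biequivariant_zero:
  assumes closed: "\<And>u v. \<lbrakk>u \<in> S; v \<in> S\<rbrakk> \<Longrightarrow> T u v \<in> S"
    and right: "\<And>u v. \<lbrakk>u \<in> S; v \<in> S\<rbrakk> \<Longrightarrow> T u (I v) = I (T u v)"
      "\<And>u v. \<lbrakk>u \<in> S; v \<in> S\<rbrakk> \<Longrightarrow> T u (J v) = J (T u v)"
    and left: "\<And>u v. \<lbrakk>u \<in> S; v \<in> S\<rbrakk> \<Longrightarrow> T (I u) v = I (T u v)"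
      "\<And>u v. \<lbrakk>u \<in> S; v \<in> S\<rbrakk> \<Longrightarrow> T (J u) v = J (T u v)"
    and "u \<in> S" "v \<in> S"
  shows "T u v = 0"
proof -
  have "T (I u) (J v) = K (T u v)" "T (I u) (J v) = - K (T u v)"
    using assms(6,7) left(1)[of u "J v"] right(2)[of u v] right(2)[of "I u" v] left(1)[of u v] closed
    by simp_all
  then have "K (T u v) = - K (T u v)" by (rule trans[OF sym])
  then have "K (T u v) + K (T u v) = 0" by (simp only: eq_neg_iff_add_eq_0)
  then have "K (T u v) = 0" by (rule double_zero[OF K_closed[OF closed[OF assms(6,7)]]])
  then have "K (K (T u v)) = 0" using zero_image[OF assms(6)] by simp
  then show ?thesis using closed assms(6,7) by simp
qed

end

locale quaternionic_bracket = quaternionic S I J K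
  for S :: "'a::ab_group_add set" and I J K +
  fixes C :: "'a \<Rightarrow> 'a \<Rightarrow> 'a"
  assumes C_closed [simp]: "\<lbrakk>u \<in> S; v \<in> S\<rbrakk> \<Longrightarrow> C u v \<in> S"
    and C_add_right: "\<lbrakk>u \<in> S; v \<in> S; w \<in> S\<rbrakk> \<Longrightarrow> C u (v + w) = C u v + C u w"
    and C_skew: "\<lbrakk>u \<in> S; v \<in> S\<rbrakk> \<Longrightarrow> C v u = - C u v"
begin

lemma C_add_left:
  assumes "u \<in> S" "v \<in> S" "w \<in> S"
  shows "C (v + w) u = C v u + C w u"
  unfolding C_skew[OF assms(1) add_closed[OF assms(2,3)]] C_skew[OF assms(1,2)] C_skew[OF assms(1,3)]
    C_add_right[OF assms]
  by simp

lemma C_minus_right: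
  assumes "u \<in> S" "v \<in> S"
  shows "C u (- v) = - C u v"
proof -
  have 0: "0 \<in> S" using diff_closed[of u u] assms by simp
  have "C u 0 = 0" using C_add_right[OF assms(1) 0 0] by simp
  then show ?thesis
    using C_add_right[OF assms(1,2) minus_closed[OF assms(2)]]
    by (simp add: eq_neg_iff_add_eq_0 add.commute)
qed

lemma swap_quaternionic_bracket: "quaternionic_bracket S J I (\<lambda>u. - K u) C"
proof (intro quaternionic_bracket.intro quaternionic_bracket_axioms.intro swap_quaternionic)
  show "C v u = - C u v" if "u \<in> S" "v \<in> S" for u v
    using that by (rule C_skew)
qed (simp_all add: C_add_right)

text \<open>
  Twice the Obata connection of the skew bracket \<open>C\<close>. The formula is forced: if
  \<open>C(u, v) = \<nabla>\<^sub>u v - \<nabla>\<^sub>v u\<close> and \<open>\<nabla>\<close> commutes with \<open>I\<close> and \<open>J\<close> in \<open>v\<close>, then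
  \<open>C(Iu, Jv) - J C(Iu, v) - I C(u, Jv) = - K (\<nabla>\<^sub>u v + \<nabla>\<^sub>v u)\<close>; applying \<open>K\<close> and
  adding \<open>C(u, v)\<close> isolates \<open>2 \<nabla>\<^sub>u v\<close>.
\<close>

definition obata :: "'a \<Rightarrow> 'a \<Rightarrow> 'a" where
  "obata u v = C u v + K (C (I u) (J v)) + I (C (I u) v) - J (C u (J v))"

lemma obata_closed [simp]: "\<lbrakk>u \<in> S; v \<in> S\<rbrakk> \<Longrightarrow> obata u v \<in> S"
  by (simp add: obata_def)

lemma obata_J: "\<lbrakk>u \<in> S; v \<in> S\<rbrakk> \<Longrightarrow> obata u (J v) = J (obata u v)"
  by (simp add: obata_def linear_simps C_minus_right algebra_simps)

text \<open>
  In contrast to \<open>J\<close>, commutation with \<open>I\<close> is obstructed, and only by \<open>\<N>(I, I)\<close>. The left-hand side is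
  doubled because the concomitant of an endomorphism with itself contains each term twice.
\<close>

lemma obata_I_defect:
  assumes "u \<in> S" "v \<in> S"
  shows "(obata u (I v) - I (obata u v)) + (obata u (I v) - I (obata u v)) =
    I (nij C I I u v) - K (nij C I I u (J v))"
  using assms by (simp add: obata_def nij_def linear_simps C_minus_right algebra_simps)

lemma obata_I:
  assumes "nij_zero S C I I" "u \<in> S" "v \<in> S"
  shows "obata u (I v) = I (obata u v)"
proof -
  let ?d = "obata u (I v) - I (obata u v)"
  have "nij C I I u v = 0" "nij C I I u (J v) = 0"
    using assms by (simp_all add: nij_zero_def)
  then have "?d + ?d = 0"
    using IJK_diff[of u u] obata_I_defect[OF assms(2,3)] assms(2) by simp
  moreover have "?d \<in> S" using assms by simp
  ultimately have "?d = 0" by (rule double_zero[rotated])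
  then show ?thesis by simp
qed

text \<open>
  Skewness of \<open>C\<close> gathers the summands of \<open>obata u v\<close> and \<open>obata v u\<close> into the eight terms of \<open>\<N>(I, J)\<close>;
  the terms \<open>IJ C\<close> and \<open>JI C\<close> of the latter cancel each other.
\<close>

lemma obata_torsion:
  assumes "u \<in> S" "v \<in> S"
  shows "obata u v - obata v u = C u v + C u v + K (nij C I J u v)"
proof -
  have "C v u = - C u v" "C (I v) u = - C u (I v)" "C v (J u) = - C (J u) v"
    "C (I v) (J u) = - C (J u) (I v)"
    using assms by (auto intro!: C_skew)
  then show ?thesis
    using assms by (simp add: obata_def nij_def linear_simps algebra_simps)
qed

text \<open>
  In the concomitant of a map commuting with \<open>F\<close> and \<open>G\<close> in the second argument, the terms cancel in
  pairs; in that of its transpose the terms \<open>FG\<close> and \<open>GF\<close> survive, and cancel after symmetrisation.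
  Doubling \<open>C\<close> makes the lemma applicable to \<open>obata\<close>, which is twice a connection.
\<close>

lemma nij_zero_of_equivariant:
  assumes W: "\<And>u v. \<lbrakk>u \<in> S; v \<in> S\<rbrakk> \<Longrightarrow> W u v \<in> S"
    and torsion: "\<And>u v. \<lbrakk>u \<in> S; v \<in> S\<rbrakk> \<Longrightarrow> W u v - W v u = C u v + C u v"
    and F: "\<And>u. u \<in> S \<Longrightarrow> F u \<in> S" "\<And>u v. \<lbrakk>u \<in> S; v \<in> S\<rbrakk> \<Longrightarrow> F (u + v) = F u + F v"
      "\<And>u v. \<lbrakk>u \<in> S; v \<in> S\<rbrakk> \<Longrightarrow> W u (F v) = F (W u v)"
    and G: "\<And>u. u \<in> S \<Longrightarrow> G u \<in> S" "\<And>u v. \<lbrakk>u \<in> S; v \<in> S\<rbrakk> \<Longrightarrow> G (u + v) = G u + G v"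
      "\<And>u v. \<lbrakk>u \<in> S; v \<in> S\<rbrakk> \<Longrightarrow> W u (G v) = G (W u v)"
  shows "nij_zero S C F G"
  unfolding nij_zero_def
proof (intro ballI)
  fix u v assume uv: "u \<in> S" "v \<in> S"
  have Fd: "F (x - y) = F x - F y" and Gd: "G (x - y) = G x - G y" if "x \<in> S" "y \<in> S" for x y
    using F(2)[of "x - y" y] G(2)[of "x - y" y] that by (simp_all add: algebra_simps)
  have double: "nij C F G u v + nij C F G u v = nij (\<lambda>u v. W u v - W v u) F G u v"
    using uv by (simp add: nij_def torsion F(1,2) G(1,2) algebra_simps)
  also have "\<dots> = 0"
    using uv by (simp add: nij_def W F G Fd Gd)
  finally have "nij C F G u v + nij C F G u v = 0" .
  moreover have "nij C F G u v \<in> S"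
    using uv by (simp add: nij_def F(1) G(1))
  ultimately show "nij C F G u v = 0" by (rule double_zero[rotated])
qed

text \<open>
  This is what allows the passage from the Dorfman bracket, which is not skew, to a skew bracket with
  the same concomitants.
\<close>

lemma nij_zero_subtract_equivariant:
  assumes closed: "\<And>u v. \<lbrakk>u \<in> S; v \<in> S\<rbrakk> \<Longrightarrow> B u v \<in> S" "\<And>u v. \<lbrakk>u \<in> S; v \<in> S\<rbrakk> \<Longrightarrow> W u v \<in> S"
    and F: "\<And>u. u \<in> S \<Longrightarrow> F u \<in> S" "\<And>u v. \<lbrakk>u \<in> S; v \<in> S\<rbrakk> \<Longrightarrow> F (u - v) = F u - F v"
      "\<And>u v. \<lbrakk>u \<in> S; v \<in> S\<rbrakk> \<Longrightarrow> W u (F v) = F (W u v)"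
    and G: "\<And>u. u \<in> S \<Longrightarrow> G u \<in> S" "\<And>u v. \<lbrakk>u \<in> S; v \<in> S\<rbrakk> \<Longrightarrow> G (u - v) = G u - G v"
      "\<And>u v. \<lbrakk>u \<in> S; v \<in> S\<rbrakk> \<Longrightarrow> W u (G v) = G (W u v)"
  shows "nij_zero S (\<lambda>u v. B u v - W u v) F G \<longleftrightarrow> nij_zero S B F G"
proof -
  have "nij (\<lambda>u v. B u v - W u v) F G u v = nij B F G u v" if "u \<in> S" "v \<in> S" for u v
    using that by (simp add: nij_def closed F G)
  then show ?thesis by (simp add: nij_zero_def)
qed

text \<open>
  If \<open>\<N>(I, J) = 0\<close>, then \<open>2 C\<close> is the alternation of \<open>obata\<close>, which always commutes with \<open>J\<close>.
\<close>

lemma nij_JJ_of_IJ: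
  assumes "nij_zero S C I J"
  shows "nij_zero S C J J"
proof (rule nij_zero_of_equivariant[where W = obata])
  show "obata u v - obata v u = C u v + C u v" if "u \<in> S" "v \<in> S" for u v
    using obata_torsion[OF that] assms that zero_image[of u] by (simp add: nij_zero_def)
qed (simp_all add: obata_J J_add)

lemma nij_commute: "nij C F G u v = nij C G F u v"
  by (simp add: nij_def algebra_simps)

text \<open>
  The difference of the two Obata maps of \<open>(I, J)\<close> and \<open>(J, I)\<close> is \<open>K \<N>(I, J)\<close>. By hypothesis both
  commute with \<open>I\<close> and \<open>J\<close> in the second argument, and so does their difference. Since \<open>\<N>(I, J)\<close> is
  skew, the difference commutes with \<open>I\<close> and \<open>J\<close> in the first argument too, and therefore vanishes.
\<close>

lemma nij_IJ_of_II_JJ: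
  assumes II: "nij_zero S C I I" and JJ: "nij_zero S C J J"
  shows "nij_zero S C I J"
  unfolding nij_zero_def
proof (intro ballI)
  fix u v assume uv: "u \<in> S" "v \<in> S"
  interpret swap: quaternionic_bracket S J I "\<lambda>u. - K u" C
    by (rule swap_quaternionic_bracket)
  have diff: "K (nij C I J x y) = obata x y - swap.obata x y" if "x \<in> S" "y \<in> S" for x y
    using that by (simp add: obata_def swap.obata_def nij_def linear_simps algebra_simps)
  have skew: "nij C I J y x = - nij C I J x y" if "x \<in> S" "y \<in> S" for x y
  proof -
    have "C y x = - C x y" "C (I y) (J x) = - C (J x) (I y)" "C (J y) (I x) = - C (I x) (J y)"
      "C (I y) x = - C x (I y)" "C (J y) x = - C x (J y)" "C y (I x) = - C (I x) y"
      "C y (J x) = - C (J x) y"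
      using that by (auto intro!: C_skew)
    then show ?thesis using that by (simp add: nij_def linear_simps algebra_simps)
  qed
  have closed: "nij C I J x y \<in> S" if "x \<in> S" "y \<in> S" for x y
    using that by (simp add: nij_def)
  have right: "K (nij C I J x (I y)) = I (K (nij C I J x y))"
      "K (nij C I J x (J y)) = J (K (nij C I J x y))" if "x \<in> S" "y \<in> S" for x y
    unfolding diff[OF that] diff[OF that(1) I_closed[OF that(2)]] diff[OF that(1) J_closed[OF that(2)]]
    using obata_I[OF II that] obata_J[OF that] swap.obata_I[OF JJ that] swap.obata_J[OF that] that
    by (simp_all add: IJK_diff)
  have K_skew: "K (nij C I J x y) = - K (nij C I J y x)" if "x \<in> S" "y \<in> S" for x y
    using that skew[of y x] closed by (simp add: K_minus)
  have "K (nij C I J u v) = 0"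
  proof (rule biequivariant_zero[where T = "\<lambda>x y. K (nij C I J x y)"])
    fix x y assume xy: "x \<in> S" "y \<in> S"
    show "K (nij C I J (I x) y) = I (K (nij C I J x y))"
      using K_skew[of "I x" y] K_skew[of x y] right(1)[of y x] xy closed by (simp add: I_minus)
    show "K (nij C I J (J x) y) = J (K (nij C I J x y))"
      using K_skew[of "J x" y] K_skew[of x y] right(2)[of y x] xy closed by (simp add: J_minus)
  qed (use right closed uv in auto)
  then have "K (K (nij C I J u v)) = 0" using zero_image[of u] uv by simp
  then show "nij C I J u v = 0" using closed uv by simp
qed

lemma nij_IJ_imp_II_JJ:
  assumes "nij_zero S C I J"
  shows "nij_zero S C I I" "nij_zero S C J J"
proof -
  interpret swap: quaternionic_bracket S J I "\<lambda>u. - K u" C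
    by (rule swap_quaternionic_bracket)
  show "nij_zero S C J J" using nij_JJ_of_IJ[OF assms] .
  show "nij_zero S C I I"
    using assms by (intro swap.nij_JJ_of_IJ) (simp add: nij_zero_def nij_commute[of J I])
qed

lemma obata_K:
  assumes "nij_zero S C I I" "u \<in> S" "v \<in> S"
  shows "obata u (K v) = K (obata u v)"
  using obata_I[OF assms(1,2), of "J v"] obata_J[OF assms(2,3)] assms by simp

text \<open>
  Under this hypothesis \<open>obata\<close> commutes with each of \<open>I\<close>, \<open>J\<close>, \<open>K\<close> and has alternation \<open>2 C\<close>, so
  the concomitants of all pairs vanish together.
\<close>

lemma nij_zero_all:
  assumes "nij_zero S C I J" "F \<in> {I, J, K}" "G \<in> {I, J, K}"
  shows "nij_zero S C F G"
proof (rule nij_zero_of_equivariant[where W = obata])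
  show "obata u v - obata v u = C u v + C u v" if "u \<in> S" "v \<in> S" for u v
    using obata_torsion[OF that] assms that zero_image[of u] by (simp add: nij_zero_def)
qed (use assms nij_IJ_imp_II_JJ in \<open>auto simp: obata_I obata_J obata_K linear_simps\<close>)

end

section \<open>Smooth functions on open sets\<close>

text \<open>
  Partial derivatives at a point of a relatively open subset of \<open>\<real>\<^sup>n\<close> only see values on that subset.
\<close>

lemma eventually_slice_mem:
  assumes W: "openin (Euclidean_space n) W" and "x \<in> W" "i < n"
  shows "\<forall>\<^sub>F t in nhds (x i). x(i := t) \<in> W"
proof -
  obtain T where T: "open T" "W = T \<inter> {x. \<forall>i\<ge>n. x i = 0}"
    using W by (auto simp: Euclidean_space_def openin_subtopology euclidean_product_topology)
  have "continuous_on UNIV (\<lambda>t. x(i := t))"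
  proof (rule continuous_on_coordinatewise_then_product)
    show "continuous_on UNIV (\<lambda>t. (x(i := t)) j)" for j
      by (cases "j = i") simp_all
  qed
  then have "open ((\<lambda>t. x(i := t)) -` T)"
    using T(1) by (rule open_vimage[rotated])
  moreover have "x i \<in> (\<lambda>t. x(i := t)) -` T"
    using T(2) \<open>x \<in> W\<close> by simp
  ultimately have "\<forall>\<^sub>F t in nhds (x i). t \<in> (\<lambda>t. x(i := t)) -` T"
    by (rule eventually_nhds_in_open)
  then show ?thesis
    using T(2) \<open>x \<in> W\<close> \<open>i < n\<close> by (auto elim: eventually_mono)
qed

lemma slice_cong:
  assumes "openin (Euclidean_space n) W" "x \<in> W" "i < n" "\<And>y. y \<in> W \<Longrightarrow> f y = g y"
  shows "(\<lambda>t. f (x(i := t))) differentiable at (x i) \<longleftrightarrow> (\<lambda>t. g (x(i := t))) differentiable at (x i)"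
    and "partial_deriv i f x = partial_deriv i g x"
proof -
  have ev: "\<forall>\<^sub>F t in nhds (x i). f (x(i := t)) = g (x(i := t))"
    using eventually_slice_mem[OF assms(1-3)] by (rule eventually_mono) (rule assms(4))
  show "partial_deriv i f x = partial_deriv i g x"
    unfolding partial_deriv_def by (rule deriv_cong_ev[OF ev refl])
  show "(\<lambda>t. f (x(i := t))) differentiable at (x i) \<longleftrightarrow> (\<lambda>t. g (x(i := t))) differentiable at (x i)"
    unfolding real_differentiable_def using DERIV_cong_ev[OF refl ev refl] by simp
qed

text \<open>
  A function expressed in a chart has arbitrary values outside the chart domain, so smoothness has to
  be insensitive to them.
\<close>

lemma Ck_on_cong:
  assumes "openin (Euclidean_space n) W" "\<And>x. x \<in> W \<Longrightarrow> f x = g x" "Ck_on n k W f"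
  shows "Ck_on n k W g"
  using assms(2,3)
proof (induction k arbitrary: f g)
  case 0
  then show ?case using continuous_on_cong[of W W f g] by simp
next
  case (Suc k)
  have "Ck_on n k W (partial_deriv i g)" if "i < n" for i
  proof (rule Suc.IH)
    show "Ck_on n k W (partial_deriv i f)" using Suc.prems that by simp
    show "partial_deriv i f x = partial_deriv i g x" if "x \<in> W" for x
      using slice_cong(2)[OF assms(1) that \<open>i < n\<close>] Suc.prems(1) .
  qed
  moreover have "(\<lambda>t. g (x(i := t))) differentiable at (x i)" if "i < n" "x \<in> W" for i x
    using slice_cong(1)[OF assms(1) that(2,1), of f g] Suc.prems that by simp
  moreover have "continuous_on W g"
    using Suc.prems continuous_on_cong[of W W f g] by simp
  ultimately show ?case by simp
qed

lemma Ck_on_lower: "Ck_on n (Suc k) W f \<Longrightarrow> Ck_on n k W f"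
  by (induction k arbitrary: f) auto

lemma Ck_on_subset: "Ck_on n k W f \<Longrightarrow> V \<subseteq> W \<Longrightarrow> Ck_on n k V f"
  by (induction k arbitrary: f) (auto intro: continuous_on_subset)

lemma Ck_on_const: "Ck_on n k W (\<lambda>_. c)"
proof (induction k arbitrary: c)
  case (Suc k)
  have "partial_deriv i (\<lambda>_. c) = (\<lambda>_. 0)" for i
    by (simp add: partial_deriv_def fun_eq_iff)
  then show ?case using Suc by simp
qed simp

lemma Ck_on_add:
  assumes W: "openin (Euclidean_space n) W" and "Ck_on n k W f" "Ck_on n k W g"
  shows "Ck_on n k W (\<lambda>x. f x + g x)"
  using assms(2,3)
proof (induction k arbitrary: f g)
  case 0
  then show ?case by (simp add: continuous_on_add)
next
  case (Suc k)
  have "Ck_on n k W (partial_deriv i (\<lambda>x. f x + g x))" if "i < n" for i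
  proof (rule Ck_on_cong[OF W])
    show "Ck_on n k W (\<lambda>x. partial_deriv i f x + partial_deriv i g x)"
      using Suc that by simp
    show "partial_deriv i f x + partial_deriv i g x = partial_deriv i (\<lambda>x. f x + g x) x"
      if "x \<in> W" for x
      using Suc.prems that \<open>i < n\<close>
      by (simp add: partial_deriv_def real_differentiable_def field_differentiable_def)
  qed
  then show ?case
    using Suc.prems by (auto intro!: continuous_on_add differentiable_add)
qed

lemma Ck_on_mult:
  assumes W: "openin (Euclidean_space n) W" and "Ck_on n k W f" "Ck_on n k W g"
  shows "Ck_on n k W (\<lambda>x. f x * g x)"
  using assms(2,3)
proof (induction k arbitrary: f g)
  case 0
  then show ?case by (simp add: continuous_on_mult)
next
  case (Suc k)
  have "Ck_on n k W (partial_deriv i (\<lambda>x. f x * g x))" if "i < n" for i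
  proof (rule Ck_on_cong[OF W])
    show "Ck_on n k W (\<lambda>x. f x * partial_deriv i g x + partial_deriv i f x * g x)"
      using Suc that Ck_on_lower by (intro Ck_on_add[OF W] Suc.IH) auto
    show "f x * partial_deriv i g x + partial_deriv i f x * g x = partial_deriv i (\<lambda>x. f x * g x) x"
      if "x \<in> W" for x
      using Suc.prems that \<open>i < n\<close>
      by (simp add: partial_deriv_def real_differentiable_def field_differentiable_def)
  qed
  then show ?case
    using Suc.prems by (auto intro!: continuous_on_mult differentiable_mult)
qed

text \<open>
  Needed to pass from trivialising open sets, on which the pairing of two sections has a formula, to
  the whole manifold.
\<close>

lemma Ck_on_local:
  assumes "\<And>x. x \<in> W \<Longrightarrow> \<exists>V. openin (Euclidean_space n) V \<and> x \<in> V \<and> Ck_on n k V f"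
    and "W \<subseteq> topspace (Euclidean_space n)"
  shows "Ck_on n k W f"
proof -
  have cont: "continuous_on W g"
    if loc: "\<And>x. x \<in> W \<Longrightarrow> \<exists>V. openin (Euclidean_space n) V \<and> x \<in> V \<and> continuous_on V g"
    for g :: "(nat \<Rightarrow> real) \<Rightarrow> real"
    unfolding continuous_on_eq_continuous_within
  proof
    fix x assume "x \<in> W"
    then obtain V where V: "openin (Euclidean_space n) V" "x \<in> V" "continuous_on V g"
      using loc by blast
    obtain T where T: "open T" "V = T \<inter> topspace (Euclidean_space n)"
      using V(1) by (auto simp: Euclidean_space_def openin_subtopology euclidean_product_topology)
    have "continuous (at x within V) g"
      using V(2,3) by (simp add: continuous_on_eq_continuous_within)
    then have "continuous (at x within (T \<inter> W)) g"
      by (rule continuous_within_subset) (use T(2) assms(2) in auto)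
    moreover have "at x within (T \<inter> W) = at x within W"
      by (rule at_within_nhd[of x T]) (use T V(2) in auto)
    ultimately show "continuous (at x within W) g" by simp
  qed
  show ?thesis
    using assms(1)
  proof (induction k arbitrary: f)
    case 0
    then show ?case using cont by simp
  next
    case (Suc k)
    have "Ck_on n k W (partial_deriv i f)" if "i < n" for i
      by (rule Suc.IH) (use Suc.prems that in fastforce)
    moreover have "continuous_on W f"
      by (rule cont) (use Suc.prems in fastforce)
    moreover have "(\<lambda>t. f (x(i := t))) differentiable at (x i)" if "i < n" "x \<in> W" for i x
      using Suc.prems[OF that(2)] that(1) by auto
    ultimately show ?case by simp
  qed
qed

lemma openin_chart_image:
  assumes M: "smooth_manifold M" and chart: "(U, \<phi>) \<in> charts M" and "open W"
  shows "openin (Euclidean_space (mdim M)) (\<phi> ` (U \<inter> W))"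
proof -
  have hom: "homeomorphism U (\<phi> ` U) \<phi> (inv_into U \<phi>)"
    and op: "openin (Euclidean_space (mdim M)) (\<phi> ` U)"
    using M chart unfolding smooth_manifold_def by auto
  have "openin (top_of_set (\<phi> ` U)) (\<phi> ` (U \<inter> W))"
    by (rule homeomorphism_imp_open_map[OF hom]) (simp add: openin_open_Int \<open>open W\<close>)
  then obtain T where "open T" "\<phi> ` (U \<inter> W) = \<phi> ` U \<inter> T"
    by (auto simp: openin_open)
  moreover have "openin (Euclidean_space (mdim M)) (\<phi> ` U \<inter> T)"
    using op \<open>open T\<close>
    by (auto simp: Euclidean_space_def openin_subtopology euclidean_product_topology)
  ultimately show ?thesis by simp
qed

lemma inv_chart_mem:
  assumes "smooth_manifold M" "(U, \<phi>) \<in> charts M" "x \<in> \<phi> ` (U \<inter> W)"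
  shows "inv_into U \<phi> x \<in> W"
proof -
  have "homeomorphism U (\<phi> ` U) \<phi> (inv_into U \<phi>)"
    using assms(1,2) unfolding smooth_manifold_def by auto
  then show ?thesis using assms(3) by (auto simp: homeomorphism_def)
qed

lemma smooth_fun_on_cong:
  assumes M: "smooth_manifold M" and W: "open W"
    and "\<And>p. p \<in> W \<Longrightarrow> f p = g p" and "smooth_fun_on M W f"
  shows "smooth_fun_on M W g"
  unfolding smooth_fun_on_def smooth_on_Rn_def
proof clarify
  fix U \<phi> k assume chart: "(U, \<phi>) \<in> charts M"
  show "Ck_on (mdim M) k (\<phi> ` (U \<inter> W)) (\<lambda>x. g (inv_into U \<phi> x))"
  proof (rule Ck_on_cong[OF openin_chart_image[OF M chart W]])
    show "Ck_on (mdim M) k (\<phi> ` (U \<inter> W)) (\<lambda>x. f (inv_into U \<phi> x))"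
      using assms(4) chart unfolding smooth_fun_on_def smooth_on_Rn_def by blast
  qed (use assms(3) inv_chart_mem[OF M chart] in blast)
qed

lemma smooth_fun_on_const: "smooth_fun_on M W (\<lambda>_. c)"
  by (simp add: smooth_fun_on_def smooth_on_Rn_def Ck_on_const split: prod.split)

lemma smooth_fun_on_add:
  assumes M: "smooth_manifold M" and W: "open W"
    and "smooth_fun_on M W f" "smooth_fun_on M W g"
  shows "smooth_fun_on M W (\<lambda>p. f p + g p)"
  using assms(3,4) Ck_on_add[OF openin_chart_image[OF M _ W]]
  unfolding smooth_fun_on_def smooth_on_Rn_def by fast

lemma smooth_fun_on_mult:
  assumes M: "smooth_manifold M" and W: "open W"
    and "smooth_fun_on M W f" "smooth_fun_on M W g"
  shows "smooth_fun_on M W (\<lambda>p. f p * g p)"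
  using assms(3,4) Ck_on_mult[OF openin_chart_image[OF M _ W]]
  unfolding smooth_fun_on_def smooth_on_Rn_def by fast

lemma smooth_fun_on_sum:
  assumes M: "smooth_manifold M" and W: "open W"
    and "\<And>j. j \<in> A \<Longrightarrow> smooth_fun_on M W (f j)"
  shows "smooth_fun_on M W (\<lambda>p. \<Sum>j\<in>A. f j p)"
  using assms(3)
  by (induction A rule: infinite_finite_induct)
    (simp_all add: smooth_fun_on_const smooth_fun_on_add[OF M W])

lemma smooth_fun_on_subset: "smooth_fun_on M W f \<Longrightarrow> V \<subseteq> W \<Longrightarrow> smooth_fun_on M V f"
  unfolding smooth_fun_on_def smooth_on_Rn_def
  by (blast intro: Ck_on_subset)

lemma smooth_fun_on_local:
  assumes M: "smooth_manifold M"
    and loc: "\<And>p. p \<in> W \<Longrightarrow> \<exists>V. open V \<and> p \<in> V \<and> smooth_fun_on M V f"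
  shows "smooth_fun_on M W f"
  unfolding smooth_fun_on_def smooth_on_Rn_def
proof clarify
  fix U \<phi> k assume chart: "(U, \<phi>) \<in> charts M"
  show "Ck_on (mdim M) k (\<phi> ` (U \<inter> W)) (\<lambda>x. f (inv_into U \<phi> x))"
  proof (rule Ck_on_local)
    fix x assume "x \<in> \<phi> ` (U \<inter> W)"
    then obtain p where p: "p \<in> U" "p \<in> W" "x = \<phi> p" by auto
    then obtain V where "open V" "p \<in> V" "smooth_fun_on M V f" using loc by blast
    then show "\<exists>V. openin (Euclidean_space (mdim M)) V \<and> x \<in> V \<and>
        Ck_on (mdim M) k V (\<lambda>x. f (inv_into U \<phi> x))"
      using openin_chart_image[OF M chart \<open>open V\<close>] p chart
      unfolding smooth_fun_on_def smooth_on_Rn_def by blast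
  next
    have "openin (Euclidean_space (mdim M)) (\<phi> ` U)"
      using openin_chart_image[OF M chart open_UNIV] by simp
    then have "\<phi> ` U \<subseteq> topspace (Euclidean_space (mdim M))" by (rule openin_subset)
    then show "\<phi> ` (U \<inter> W) \<subseteq> topspace (Euclidean_space (mdim M))" by auto
  qed
qed

section \<open>Sections of vector bundles\<close>

lemma fibre_linear_sum:
  assumes S: "subspace S" and h: "fibre_linear S h" and "\<And>j. j \<in> A \<Longrightarrow> v j \<in> S"
  shows "h (\<Sum>j\<in>A. c j *\<^sub>R v j) = (\<Sum>j\<in>A. c j *\<^sub>R h (v j))"
  using assms(3)
proof (induction A rule: infinite_finite_induct)
  case (insert x F)
  have "h (c x *\<^sub>R v x + (\<Sum>j\<in>F. c j *\<^sub>R v j)) = h (c x *\<^sub>R v x) + h (\<Sum>j\<in>F. c j *\<^sub>R v j)"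
    using h insert.prems S unfolding fibre_linear_def
    by (simp add: subspace_scale subspace_sum)
  then show ?case using insert h unfolding fibre_linear_def by simp
next
  case empty
  have "h (0 *\<^sub>R 0) = 0 *\<^sub>R h 0"
    using h subspace_0[OF S] unfolding fibre_linear_def by blast
  then show ?case by simp
next
  case (infinite A)
  have "h (0 *\<^sub>R 0) = 0 *\<^sub>R h 0"
    using h subspace_0[OF S] unfolding fibre_linear_def by blast
  then show ?case using infinite by simp
qed

context
  fixes E :: "('m::{t2_space,second_countable_topology}, 'v::real_vector, 'z) bundle_data_scheme"
  assumes E: "vector_bundle E"
begin

lemma manifold: "smooth_manifold E"
  using E by (simp add: vector_bundle_def)

lemma fibre_subspace: "subspace (fibre E p)"
  using E by (simp add: vector_bundle_def)

lemma triv_open: "(W, \<Phi>) \<in> trivs E \<Longrightarrow> open W"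
  using E unfolding vector_bundle_def by auto

lemma triv_exists: obtains W \<Phi> where "(W, \<Phi>) \<in> trivs E" "p \<in> W"
proof -
  have "p \<in> (\<Union>(W, \<Phi>)\<in>trivs E. W)" using E by (simp add: vector_bundle_def)
  then show ?thesis using that by blast
qed

lemma triv_bij:
  "(W, \<Phi>) \<in> trivs E \<Longrightarrow> p \<in> W \<Longrightarrow> bij_betw (\<Phi> p) (fibre E p) (topspace (Euclidean_space (rank E)))"
  using E unfolding vector_bundle_def by blast

lemma triv_linear:
  "(W, \<Phi>) \<in> trivs E \<Longrightarrow> p \<in> W \<Longrightarrow> fibre_linear (fibre E p) (\<lambda>v. \<Phi> p v i)"
  using E unfolding vector_bundle_def by blast

lemma frame_mem:
  assumes "(W, \<Phi>) \<in> trivs E" "p \<in> W" "j < rank E"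
  shows "frame E \<Phi> j p \<in> fibre E p" "\<Phi> p (frame E \<Phi> j p) = (\<lambda>k. if k = j then 1 else 0)"
proof -
  have "(\<lambda>k. if k = j then 1 else 0) \<in> \<Phi> p ` fibre E p"
    using bij_betw_imp_surj_on[OF triv_bij[OF assms(1,2)]] assms(3) by (simp add: topspace_Euclidean_space)
  then show "frame E \<Phi> j p \<in> fibre E p" "\<Phi> p (frame E \<Phi> j p) = (\<lambda>k. if k = j then 1 else 0)"
    unfolding frame_def by (auto simp: inv_into_into f_inv_into_f)
qed

text \<open>
  Smoothness of sections, endomorphisms and pairings is defined through components in local frames;
  this expansion reduces every operation on sections to sums and products of such components.
\<close>

lemma frame_expansion:
  assumes triv: "(W, \<Phi>) \<in> trivs E" "p \<in> W" and v: "v \<in> fibre E p"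
  shows "v = (\<Sum>j<rank E. \<Phi> p v j *\<^sub>R frame E \<Phi> j p)" (is "v = ?s")
proof (rule inj_onD[OF bij_betw_imp_inj_on[OF triv_bij[OF triv]] _ v])
  show "?s \<in> fibre E p"
    using frame_mem(1)[OF triv] by (auto intro!: subspace_sum subspace_scale fibre_subspace)
  show "\<Phi> p v = \<Phi> p ?s"
  proof
    fix i
    have "\<Phi> p ?s i = (\<Sum>j<rank E. \<Phi> p v j *\<^sub>R \<Phi> p (frame E \<Phi> j p) i)"
      by (rule fibre_linear_sum[OF fibre_subspace triv_linear[OF triv]]) (use frame_mem(1)[OF triv] in auto)
    also have "\<dots> = (\<Sum>j<rank E. if i = j then \<Phi> p v j else 0)"
      using frame_mem(2)[OF triv] by (intro sum.cong) auto
    also have "\<dots> = \<Phi> p v i"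
      using bij_betw_apply[OF triv_bij[OF triv] v] by (auto simp: topspace_Euclidean_space sum.delta)
    finally show "\<Phi> p v i = \<Phi> p ?s i" ..
  qed
qed

lemma fibre_linear_frame:
  assumes triv: "(W, \<Phi>) \<in> trivs E" "p \<in> W" and "v \<in> fibre E p" and h: "fibre_linear (fibre E p) h"
  shows "h v = (\<Sum>j<rank E. \<Phi> p v j *\<^sub>R h (frame E \<Phi> j p))"
  using fibre_linear_sum[OF fibre_subspace h, of "{..<rank E}" "\<lambda>j. frame E \<Phi> j p" "\<Phi> p v"]
    frame_expansion[OF triv assms(3)] frame_mem(1)[OF triv] by simp

lemma sectionsD:
  assumes "s \<in> sections E"
  shows "s p \<in> fibre E p"
    and "(W, \<Phi>) \<in> trivs E \<Longrightarrow> i < rank E \<Longrightarrow> smooth_fun_on E W (\<lambda>p. \<Phi> p (s p) i)"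
  using assms unfolding sections_def by auto

lemma sections_add:
  assumes s: "s \<in> sections E" "t \<in> sections E"
  shows "s + t \<in> sections E"
proof -
  have "smooth_fun_on E W (\<lambda>p. \<Phi> p (s p + t p) i)"
    if triv: "(W, \<Phi>) \<in> trivs E" "i < rank E" for W \<Phi> i
  proof (rule smooth_fun_on_cong[OF manifold triv_open[OF triv(1)]])
    show "smooth_fun_on E W (\<lambda>p. \<Phi> p (s p) i + \<Phi> p (t p) i)"
      using s triv by (intro smooth_fun_on_add[OF manifold triv_open[OF triv(1)]] sectionsD)
    show "\<Phi> p (s p) i + \<Phi> p (t p) i = \<Phi> p (s p + t p) i" if "p \<in> W" for p
      using triv_linear[OF triv(1) that, of i] s sectionsD(1) unfolding fibre_linear_def by simp
  qed
  then show ?thesis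
    using s subspace_add[OF fibre_subspace] unfolding sections_def by auto
qed

lemma sections_fscale:
  assumes f: "f \<in> Cinf E" and s: "s \<in> sections E"
  shows "f \<star> s \<in> sections E"
proof -
  have "smooth_fun_on E W (\<lambda>p. \<Phi> p (f p *\<^sub>R s p) i)"
    if triv: "(W, \<Phi>) \<in> trivs E" "i < rank E" for W \<Phi> i
  proof (rule smooth_fun_on_cong[OF manifold triv_open[OF triv(1)]])
    show "smooth_fun_on E W (\<lambda>p. f p * \<Phi> p (s p) i)"
      using f smooth_fun_on_subset[of E UNIV f W]
      by (intro smooth_fun_on_mult[OF manifold triv_open[OF triv(1)]] sectionsD(2)[OF s triv])
        (simp add: Cinf_def)
    show "f p * \<Phi> p (s p) i = \<Phi> p (f p *\<^sub>R s p) i" if "p \<in> W" for p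
      using triv_linear[OF triv(1) that, of i] s sectionsD(1) unfolding fibre_linear_def by simp
  qed
  then show ?thesis
    using s subspace_scale[OF fibre_subspace] unfolding sections_def fscale_def by auto
qed

lemma endo_fibre: "bundle_endo E F \<Longrightarrow> v \<in> fibre E p \<Longrightarrow> F p v \<in> fibre E p"
  unfolding bundle_endo_def by blast

lemma endo_linear: "bundle_endo E F \<Longrightarrow> fibre_linear (fibre E p) (F p)"
  unfolding bundle_endo_def by blast

lemma endo_smooth:
  "bundle_endo E F \<Longrightarrow> (W, \<Phi>) \<in> trivs E \<Longrightarrow> i < rank E \<Longrightarrow> j < rank E \<Longrightarrow>
    smooth_fun_on E W (\<lambda>p. \<Phi> p (F p (frame E \<Phi> j p)) i)"
  unfolding bundle_endo_def by blast

lemma sections_endo: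
  assumes F: "bundle_endo E F" and s: "s \<in> sections E"
  shows "F \<cdot> s \<in> sections E"
proof -
  have "smooth_fun_on E W (\<lambda>p. \<Phi> p (F p (s p)) i)"
    if triv: "(W, \<Phi>) \<in> trivs E" "i < rank E" for W \<Phi> i
  proof (rule smooth_fun_on_cong[OF manifold triv_open[OF triv(1)]])
    show "smooth_fun_on E W (\<lambda>p. \<Sum>j<rank E. \<Phi> p (s p) j * \<Phi> p (F p (frame E \<Phi> j p)) i)"
      using sectionsD(2)[OF s triv(1)] endo_smooth[OF F triv]
      by (intro smooth_fun_on_sum smooth_fun_on_mult manifold triv_open[OF triv(1)]) simp_all
    show "(\<Sum>j<rank E. \<Phi> p (s p) j * \<Phi> p (F p (frame E \<Phi> j p)) i) = \<Phi> p (F p (s p)) i"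
      if "p \<in> W" for p
    proof -
      have "fibre_linear (fibre E p) (\<lambda>v. \<Phi> p (F p v) i)"
        using triv_linear[OF triv(1) that, of i] endo_linear[OF F, of p] endo_fibre[OF F, of _ p]
        unfolding fibre_linear_def by simp
      from fibre_linear_frame[OF triv(1) that sectionsD(1)[OF s] this] show ?thesis by simp
    qed
  qed
  then show ?thesis
    using s F unfolding sections_def endo_app_def by (auto intro: endo_fibre)
qed

end

lemma pair_smooth:
  assumes E: "vector_bundle E" and g: "bundle_pairing E (pairing E)"
    and s: "s \<in> sections E" "t \<in> sections E"
  shows "pair E s t \<in> Cinf E"
  unfolding Cinf_def mem_Collect_eq
proof (rule smooth_fun_on_local[OF manifold[OF E]])
  fix p
  obtain W \<Phi> where triv: "(W, \<Phi>) \<in> trivs E" "p \<in> W" by (rule triv_exists[OF E])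
  have smooth_g: "smooth_fun_on E W (\<lambda>p. pairing E p (frame E \<Phi> i p) (frame E \<Phi> j p))"
    if "i < rank E" "j < rank E" for i j
    using g triv(1) that unfolding bundle_pairing_def by blast
  have "smooth_fun_on E W (pair E s t)"
  proof (rule smooth_fun_on_cong[OF manifold[OF E] triv_open[OF E triv(1)]])
    show "smooth_fun_on E W (\<lambda>p. \<Sum>i<rank E. \<Phi> p (s p) i * (\<Sum>j<rank E. \<Phi> p (t p) j *
        pairing E p (frame E \<Phi> i p) (frame E \<Phi> j p)))"
      using sectionsD(2)[OF E s(1) triv(1)] sectionsD(2)[OF E s(2) triv(1)] smooth_g
      by (intro smooth_fun_on_sum smooth_fun_on_mult manifold[OF E] triv_open[OF E triv(1)]) simp_all
    fix q assume q: "q \<in> W"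
    have sq: "s q \<in> fibre E q" "t q \<in> fibre E q" using sectionsD(1)[OF E] s by auto
    have lin: "fibre_linear (fibre E q) (pairing E q u)" "fibre_linear (fibre E q) (\<lambda>v. pairing E q v u)"
      if "u \<in> fibre E q" for u
    proof -
      show 1: "fibre_linear (fibre E q) (pairing E q u)" using g that by (auto simp: bundle_pairing_def)
      have "pairing E q v u = pairing E q u v" if "v \<in> fibre E q" for v
        using g that \<open>u \<in> _\<close> by (auto simp: bundle_pairing_def)
      then show "fibre_linear (fibre E q) (\<lambda>v. pairing E q v u)"
        using 1 fibre_subspace[OF E, of q] unfolding fibre_linear_def
        by (simp add: subspace_add subspace_scale)
    qed
    have "pair E s t q = (\<Sum>i<rank E. \<Phi> q (s q) i * pairing E q (frame E \<Phi> i q) (t q))"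
      using fibre_linear_frame[OF E triv(1) q sq(1) lin(2)[OF sq(2)]] by (simp add: pair_def)
    also have "\<dots> = (\<Sum>i<rank E. \<Phi> q (s q) i * (\<Sum>j<rank E. \<Phi> q (t q) j *
        pairing E q (frame E \<Phi> i q) (frame E \<Phi> j q)))"
      using fibre_linear_frame[OF E triv(1) q sq(2) lin(1)] frame_mem(1)[OF E triv(1) q] by simp
    finally show "(\<Sum>i<rank E. \<Phi> q (s q) i * (\<Sum>j<rank E. \<Phi> q (t q) j *
        pairing E q (frame E \<Phi> i q) (frame E \<Phi> j q))) = pair E s t q" ..
  qed
  then show "\<exists>V. open V \<and> p \<in> V \<and> smooth_fun_on E V (pair E s t)"
    using triv triv_open[OF E] by blast
qed

section \<open>Courant algebroids\<close>

text \<open>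
  A linear functional that vanishes on the common kernel of finitely many others is a combination of
  them. Applied to the functionals given by pairing with a frame, it yields the vector representing
  a functional. The induction restricts to the kernel of the last functional and then corrects the
  coefficient of that functional by the value at a vector outside this kernel.
\<close>

lemma functional_combination:
  fixes f :: "nat \<Rightarrow> 'v::real_vector \<Rightarrow> real"
  assumes "subspace V" "\<And>j. j < n \<Longrightarrow> fibre_linear V (f j)" "fibre_linear V h"
    and "\<And>v. v \<in> V \<Longrightarrow> (\<And>j. j < n \<Longrightarrow> f j v = 0) \<Longrightarrow> h v = 0"
  shows "\<exists>c. \<forall>v\<in>V. h v = (\<Sum>j<n. c j * f j v)"
  using assms
proof (induction n arbitrary: V)
  case 0
  then show ?case by auto
next
  case (Suc n)
  let ?V = "{v \<in> V. f n v = 0}"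
  have fn: "fibre_linear V (f n)" using Suc.prems by simp
  have f0: "f n 0 = 0"
    using fn subspace_0[OF Suc.prems(1)] unfolding fibre_linear_def by (metis scale_zero_left)
  have "\<exists>c. \<forall>v\<in>?V. h v = (\<Sum>j<n. c j * f j v)"
  proof (rule Suc.IH)
    show "subspace ?V"
      using Suc.prems(1) fn f0 unfolding subspace_def fibre_linear_def by auto
    show "fibre_linear ?V (f j)" if "j < n" for j
      using Suc.prems(2)[of j] that unfolding fibre_linear_def by auto
    show "fibre_linear ?V h" using Suc.prems(3) unfolding fibre_linear_def by auto
    show "h v = 0" if "v \<in> ?V" "\<And>j. j < n \<Longrightarrow> f j v = 0" for v
      using Suc.prems(4)[of v] that less_Suc_eq by auto
  qed
  then obtain c where c: "\<And>v. v \<in> ?V \<Longrightarrow> h v = (\<Sum>j<n. c j * f j v)" by auto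
  show ?case
  proof (cases "\<exists>w\<in>V. f n w \<noteq> 0")
    case False
    then show ?thesis using c by (intro exI[of _ "c(n := 0)"]) auto
  next
    case True
    then obtain w where w: "w \<in> V" "f n w \<noteq> 0" by blast
    define d where "d = (h w - (\<Sum>j<n. c j * f j w)) / f n w"
    have "h v = (\<Sum>j<n. c j * f j v) + d * f n v" if v: "v \<in> V" for v
    proof -
      \<comment> \<open>With this factor, \<open>v + a w\<close> lies in the kernel of \<open>f n\<close>, where the induction hypothesis applies.\<close>
      define a where "a = - (f n v / f n w)"
      have lin: "g (v + a *\<^sub>R w) = g v + a * g w" if "fibre_linear V g" for g :: "'v \<Rightarrow> real"
        using that v w(1) Suc.prems(1) unfolding fibre_linear_def by (simp add: subspace_scale)
      have "v + a *\<^sub>R w \<in> ?V"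
        using v w Suc.prems(1) lin[OF fn] by (simp add: a_def subspace_diff subspace_scale)
      from c[OF this] have "h v + a * h w = (\<Sum>j<n. c j * (f j v + a * f j w))"
        using lin Suc.prems(2,3) by simp
      also have "\<dots> = (\<Sum>j<n. c j * f j v) + a * (\<Sum>j<n. c j * f j w)"
        by (simp add: sum.distrib sum_distrib_left algebra_simps)
      finally show ?thesis
        unfolding a_def d_def using w(2) by (simp add: field_simps)
    qed
    then show ?thesis by (intro exI[of _ "c(n := d)"]) auto
  qed
qed

locale courant =
  fixes E :: "('m::{t2_space,second_countable_topology}, 'v::real_vector) courant_data"
  assumes courant: "courant_algebroid E"
begin

lemma vbundle: "vector_bundle E" and pairing: "bundle_pairing E (pairing E)"
  and anchor: "bundle_anchor E (anchor E)" and bilinear: "bilinear_on_sections E (dorfman E)"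
  using courant by (simp_all add: courant_algebroid_def)

lemmas fib_subspace = fibre_subspace[OF vbundle]

lemma sections_fibre [simp]: "s \<in> sections E \<Longrightarrow> s p \<in> fibre E p"
  using sectionsD(1)[OF vbundle] .

lemma fibre_closed [simp]:
  "u \<in> fibre E p \<Longrightarrow> v \<in> fibre E p \<Longrightarrow> u + v \<in> fibre E p"
  "u \<in> fibre E p \<Longrightarrow> v \<in> fibre E p \<Longrightarrow> u - v \<in> fibre E p"
  "u \<in> fibre E p \<Longrightarrow> c *\<^sub>R u \<in> fibre E p" "u \<in> fibre E p \<Longrightarrow> - u \<in> fibre E p"
  using fib_subspace by (auto intro: subspace_add subspace_diff subspace_scale subspace_neg)

lemma const_Cinf [simp]: "(\<lambda>_. c) \<in> Cinf E"
  by (simp add: Cinf_def smooth_fun_on_const)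

lemma pair_Cinf [simp]: "U \<in> sections E \<Longrightarrow> V \<in> sections E \<Longrightarrow> pair E U V \<in> Cinf E"
  by (rule pair_smooth[OF vbundle pairing])

lemma sections_closed [simp]:
  "U \<in> sections E \<Longrightarrow> V \<in> sections E \<Longrightarrow> U + V \<in> sections E"
  "f \<in> Cinf E \<Longrightarrow> U \<in> sections E \<Longrightarrow> f \<star> U \<in> sections E"
  "U \<in> sections E \<Longrightarrow> V \<in> sections E \<Longrightarrow> dorfman E U V \<in> sections E"
  using sections_add[OF vbundle] sections_fscale[OF vbundle] bilinear
  by (auto simp: bilinear_on_sections_def)

lemma sections_minus [simp]: "U \<in> sections E \<Longrightarrow> - U \<in> sections E"
  using sections_closed(2)[of "\<lambda>_. -1" U] by (simp add: fscale_def fun_Compl_def)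

lemma pairing_sym: "u \<in> fibre E p \<Longrightarrow> v \<in> fibre E p \<Longrightarrow> pairing E p u v = pairing E p v u"
  using conjunct1[OF pairing[unfolded bundle_pairing_def]] by blast

lemma pairing_right:
  assumes "u \<in> fibre E p" "v \<in> fibre E p"
  shows "w \<in> fibre E p \<Longrightarrow> pairing E p u (v + w) = pairing E p u v + pairing E p u w"
    and "pairing E p u (c *\<^sub>R v) = c * pairing E p u v"
proof -
  have "fibre_linear (fibre E p) (pairing E p u)"
    using conjunct1[OF conjunct2[OF pairing[unfolded bundle_pairing_def]]] assms(1) by blast
  then show "w \<in> fibre E p \<Longrightarrow> pairing E p u (v + w) = pairing E p u v + pairing E p u w"
    "pairing E p u (c *\<^sub>R v) = c * pairing E p u v"
    using assms(2) by (simp_all add: fibre_linear_def)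
qed

lemma pairing_left:
  assumes "u \<in> fibre E p" "v \<in> fibre E p"
  shows "w \<in> fibre E p \<Longrightarrow> pairing E p (v + w) u = pairing E p v u + pairing E p w u"
    and "pairing E p (c *\<^sub>R v) u = c * pairing E p v u"
  using pairing_right[OF assms] pairing_sym[of u p] assms by simp_all

lemma pairing_minus [simp]:
  assumes "u \<in> fibre E p" "v \<in> fibre E p"
  shows "pairing E p u (- v) = - pairing E p u v" "pairing E p (- v) u = - pairing E p v u"
  using pairing_right(2)[of u p v "-1"] pairing_left(2)[of u p v "-1"] assms by simp_all

lemma nondegenerate:
  "u \<in> fibre E p \<Longrightarrow> (\<And>v. v \<in> fibre E p \<Longrightarrow> pairing E p u v = 0) \<Longrightarrow> u = 0"
  using conjunct1[OF conjunct2[OF conjunct2[OF pairing[unfolded bundle_pairing_def]]]] by blast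

lemma calD_eqI:
  assumes v: "v \<in> fibre E p" "\<And>w. w \<in> fibre E p \<Longrightarrow> pairing E p v w = anchor E p w f / 2"
  shows "calD E f p = v"
  unfolding calD_def
proof (rule the_equality)
  fix u assume u: "u \<in> fibre E p \<and> (\<forall>w\<in>fibre E p. pairing E p u w = anchor E p w f / 2)"
  have "u - v = 0"
  proof (rule nondegenerate)
    show "pairing E p (u - v) w = 0" if "w \<in> fibre E p" for w
      using pairing_left(1)[of w p u "- v"] that u v by simp
  qed (use u v in simp)
  then show "u = v" by simp
qed (use v in blast)

text \<open>
  Existence of the vector representing \<open>w \<mapsto> \<rho>(w) f / 2\<close>. By nondegeneracy the functionals given by
  pairing with a frame have no common zero but \<open>0\<close>, so this functional is a combination of them.
\<close>

lemma calD_represents: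
  assumes f: "f \<in> Cinf E"
  shows "calD E f p \<in> fibre E p" "w \<in> fibre E p \<Longrightarrow> pairing E p (calD E f p) w = anchor E p w f / 2"
proof -
  obtain W \<Phi> where triv: "(W, \<Phi>) \<in> trivs E" "p \<in> W" by (rule triv_exists[OF vbundle])
  let ?e = "\<lambda>j. frame E \<Phi> j p"
  have e: "?e j \<in> fibre E p" if "j < rank E" for j using frame_mem(1)[OF vbundle triv that] .
  have lin: "fibre_linear (fibre E p) (\<lambda>v. pairing E p v w)" if "w \<in> fibre E p" for w
    using pairing_left that unfolding fibre_linear_def by simp
  have "fibre_linear (fibre E p) (\<lambda>w. anchor E p w f)"
    using anchor f unfolding bundle_anchor_def by blast
  then have "fibre_linear (fibre E p) (\<lambda>w. anchor E p w f / 2)"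
    unfolding fibre_linear_def by (simp add: add_divide_distrib)
  have "\<exists>c. \<forall>w\<in>fibre E p. anchor E p w f / 2 = (\<Sum>j<rank E. c j * pairing E p (?e j) w)"
  proof (rule functional_combination[OF fib_subspace])
    show "fibre_linear (fibre E p) (pairing E p (?e j))" if "j < rank E" for j
      using pairing_right e[OF that] unfolding fibre_linear_def by simp
    show "anchor E p w f / 2 = 0"
      if w: "w \<in> fibre E p" "\<And>j. j < rank E \<Longrightarrow> pairing E p (?e j) w = 0" for w
    proof -
      have "w = 0"
      proof (rule nondegenerate[OF w(1)])
        show "pairing E p w v = 0" if v: "v \<in> fibre E p" for v
          using fibre_linear_frame[OF vbundle triv v lin[OF w(1)]] w(2) pairing_sym[OF w(1) v] by simp
      qed
      moreover have "anchor E p (0 *\<^sub>R w) f = 0 *\<^sub>R anchor E p w f"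
        using \<open>fibre_linear (fibre E p) (\<lambda>w. anchor E p w f)\<close> w(1)
        unfolding fibre_linear_def by blast
      ultimately show ?thesis by simp
    qed
  qed fact
  then obtain c where c: "\<And>w. w \<in> fibre E p \<Longrightarrow>
      anchor E p w f / 2 = (\<Sum>j<rank E. c j * pairing E p (?e j) w)"
    by blast
  define v where "v = (\<Sum>j<rank E. c j *\<^sub>R ?e j)"
  have v: "v \<in> fibre E p"
    unfolding v_def using e by (intro subspace_sum fib_subspace) simp
  have pv: "pairing E p v w = anchor E p w f / 2" if "w \<in> fibre E p" for w
    unfolding v_def c[OF that]
    using fibre_linear_sum[OF fib_subspace lin[OF that], of "{..<rank E}" ?e c] e by simp
  have "calD E f p = v" using v pv by (rule calD_eqI)
  then show "calD E f p \<in> fibre E p"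
    "w \<in> fibre E p \<Longrightarrow> pairing E p (calD E f p) w = anchor E p w f / 2"
    using v pv by simp_all
qed

lemmas calD_fibre [simp] = calD_represents(1)

lemma anchor_derivation:
  assumes "w \<in> fibre E p" "f \<in> Cinf E" "g \<in> Cinf E"
  shows "anchor E p w (f + g) = anchor E p w f + anchor E p w g"
    "anchor E p w (f * g) = f p * anchor E p w g + g p * anchor E p w f"
    "anchor E p w (\<lambda>q. c * f q) = c * anchor E p w f"
  using anchor assms unfolding bundle_anchor_def tangent_vector_def by blast+

lemma anchor_const:
  assumes "w \<in> fibre E p"
  shows "anchor E p w (\<lambda>_. c) = 0"
proof -
  have "anchor E p w (\<lambda>_. 1) = 0"
    using anchor_derivation(2)[OF assms const_Cinf const_Cinf, of 1 1] by (simp add: times_fun_def)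
  then show ?thesis
    using anchor_derivation(3)[OF assms const_Cinf const_Cinf, of c 1] by simp
qed

lemma calD_add:
  assumes "f \<in> Cinf E" "g \<in> Cinf E"
  shows "calD E (f + g) = calD E f + calD E g"
proof
  show "calD E (f + g) p = (calD E f + calD E g) p" for p
    by (rule calD_eqI)
      (use assms in \<open>simp_all add: pairing_left calD_represents anchor_derivation add_divide_distrib\<close>)
qed

lemma calD_mult:
  assumes "f \<in> Cinf E" "g \<in> Cinf E"
  shows "calD E (f * g) = f \<star> calD E g + g \<star> calD E f"
proof
  show "calD E (f * g) p = (f \<star> calD E g + g \<star> calD E f) p" for p
    by (rule calD_eqI)
      (use assms in \<open>simp_all add: fscale_def pairing_left calD_represents anchor_derivation add_divide_distrib\<close>)
qed

lemma calD_const: "calD E (\<lambda>_. c) = 0"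
proof
  show "calD E (\<lambda>_. c) p = 0 p" for p
  proof (rule calD_eqI)
    show "0 p \<in> fibre E p" using subspace_0[OF fib_subspace] by simp
    show "pairing E p (0 p) w = anchor E p w (\<lambda>_. c) / 2" if "w \<in> fibre E p" for w
      using pairing_left(2)[of w p w 0] anchor_const[OF that] that by simp
  qed
qed

lemma calD_minus:
  assumes "f \<in> Cinf E"
  shows "calD E (- f) = - calD E f"
proof -
  have "calD E ((\<lambda>_. -1) * f) = - calD E f"
    using calD_mult[OF const_Cinf assms, of "-1"]
    by (simp add: calD_const fscale_def fun_eq_iff)
  then show ?thesis by (simp add: times_fun_def fun_Compl_def)
qed

lemma dorfman_sym:
  assumes "U \<in> sections E" "V \<in> sections E"
  shows "dorfman E U V + dorfman E V U = calD E (pair E U V) + calD E (pair E U V)"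
proof -
  have "dorfman E U V + dorfman E V U = (\<lambda>p. 2) \<star> calD E (pair E U V)"
    using courant assms by (simp add: courant_algebroid_def)
  then show ?thesis by (simp add: fscale_def fun_eq_iff scaleR_2)
qed

text \<open>
  The values \<open>\<D>\<langle>U, V\<rangle>\<close> are smooth because they are symmetrised brackets.
\<close>

lemma calD_pair_sections [simp]:
  assumes "U \<in> sections E" "V \<in> sections E"
  shows "calD E (pair E U V) \<in> sections E"
proof -
  have "calD E (pair E U V) = (\<lambda>_. 1/2) \<star> (dorfman E U V + dorfman E V U)"
    unfolding dorfman_sym[OF assms] by (simp add: fscale_def fun_eq_iff flip: scaleR_2)
  then show ?thesis using assms by simp
qed

lemma dorfman_add_right:
  "\<lbrakk>U \<in> sections E; V \<in> sections E; W \<in> sections E\<rbrakk> \<Longrightarrow>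
    dorfman E U (V + W) = dorfman E U V + dorfman E U W"
  using bilinear unfolding bilinear_on_sections_def by blast

lemma dorfman_leibniz:
  "\<lbrakk>U \<in> sections E; V \<in> sections E; f \<in> Cinf E\<rbrakk> \<Longrightarrow>
    dorfman E U (f \<star> V) = lie E U f \<star> V + f \<star> dorfman E U V"
  using courant unfolding courant_algebroid_def by blast

lemma pair_add: "\<lbrakk>U \<in> sections E; V \<in> sections E; W \<in> sections E\<rbrakk> \<Longrightarrow>
    pair E U (V + W) = pair E U V + pair E U W"
  by (simp add: pair_def fun_eq_iff pairing_right)

lemma pair_fscale: "\<lbrakk>U \<in> sections E; V \<in> sections E\<rbrakk> \<Longrightarrow> pair E U (f \<star> V) = f * pair E U V"
  by (simp add: pair_def fun_eq_iff pairing_right fscale_def)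

lemma pair_minus: "\<lbrakk>U \<in> sections E; V \<in> sections E\<rbrakk> \<Longrightarrow> pair E U (- V) = - pair E U V"
  by (simp add: pair_def fun_eq_iff)

lemma pair_sym: "\<lbrakk>U \<in> sections E; V \<in> sections E\<rbrakk> \<Longrightarrow> pair E V U = pair E U V"
  by (simp add: pair_def fun_eq_iff pairing_sym)

end

section \<open>Almost hypercomplex structures\<close>

locale almost_hypercomplex_courant = courant E
  for E :: "('m::{t2_space,second_countable_topology}, 'v::real_vector) courant_data" +
  fixes I J K :: "'m \<Rightarrow> 'v \<Rightarrow> 'v"
  assumes hyper: "almost_hypercomplex E I J K"
begin

lemma complex_structures: "almost_complex E I" "almost_complex E J" "almost_complex E K"
  using hyper by (simp_all add: almost_hypercomplex_def)

lemma endos: "bundle_endo E I" "bundle_endo E J" "bundle_endo E K"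
  using complex_structures by (simp_all add: almost_complex_def)

lemma endo_fibre_closed [simp]:
  "u \<in> fibre E p \<Longrightarrow> I p u \<in> fibre E p" "u \<in> fibre E p \<Longrightarrow> J p u \<in> fibre E p"
  "u \<in> fibre E p \<Longrightarrow> K p u \<in> fibre E p"
  using endo_fibre[OF vbundle] endos by blast+

lemma endo_scale:
  "u \<in> fibre E p \<Longrightarrow> I p (c *\<^sub>R u) = c *\<^sub>R I p u"
  "u \<in> fibre E p \<Longrightarrow> J p (c *\<^sub>R u) = c *\<^sub>R J p u"
  "u \<in> fibre E p \<Longrightarrow> K p (c *\<^sub>R u) = c *\<^sub>R K p u"
  using endo_linear[OF vbundle] endos unfolding fibre_linear_def by blast+

text \<open>
  Only \<open>IJK = -1\<close> is given; with \<open>K\<^sup>2 = -1\<close> it gives \<open>IJ = K\<close>, and then \<open>(IJ)\<^sup>2 = -1\<close> gives \<open>JI = - K\<close>.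
\<close>

lemma fibre_quaternionic: "quaternionic (fibre E p) (I p) (J p) (K p)"
proof
  fix u v assume u: "u \<in> fibre E p"
  have neg: "F p (- w) = - F p w" if "bundle_endo E F" "w \<in> fibre E p" for F w
  proof -
    have "F p ((-1) *\<^sub>R w) = (-1) *\<^sub>R F p w"
      using endo_linear[OF vbundle that(1), of p] that(2) unfolding fibre_linear_def by blast
    then show ?thesis by simp
  qed
  show "I p (I p u) = - u" "J p (J p u) = - u"
    using complex_structures u unfolding almost_complex_def by blast+
  have KK: "K p (K p w) = - w" and JJ: "J p (J p w) = - w" and II: "I p (I p w) = - w" if "w \<in> fibre E p" for w
    using complex_structures that unfolding almost_complex_def by blast+
  have IJK: "I p (J p (K p w)) = - w" if "w \<in> fibre E p" for w
    using hyper that unfolding almost_hypercomplex_def by blast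
  have IJ: "I p (J p w) = K p w" if "w \<in> fibre E p" for w
    using IJK[of "- K p w"] that KK[OF that] neg[OF endos(3), of "K p w"] by simp
  then show "I p (J p u) = K p u" using u .
  have "I p (J p (I p (J p w))) = - w" if "w \<in> fibre E p" for w
    using IJ[of "I p (J p w)"] IJ[OF that] KK[OF that] that by simp
  from this[of "J p u"] have *: "I p (J p (I p (- u))) = - J p u" using JJ[OF u] u by simp
  have "I p (J p (I p u)) = J p u"
    using * u neg[OF endos(1), of u] neg[OF endos(2), of "I p u"] neg[OF endos(1), of "J p (I p u)"] by simp
  then have "I p (I p (J p (I p u))) = K p u" using IJ[OF u] by simp
  then show "J p (I p u) = - K p u" using II[of "J p (I p u)"] u by (simp add: minus_equation_iff)
next
  fix u v assume "u \<in> fibre E p" "v \<in> fibre E p"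
  then show "I p (u + v) = I p u + I p v" "J p (u + v) = J p u + J p v"
    using endo_linear[OF vbundle] endos unfolding fibre_linear_def by blast+
next
  fix u assume "u \<in> fibre E p" "u + u = 0"
  then show "u = 0" by (simp flip: scaleR_2)
qed simp_all

sublocale fib: quaternionic "fibre E p" "I p" "J p" "K p" for p
  by (rule fibre_quaternionic)

lemma endo_sections [simp]:
  "U \<in> sections E \<Longrightarrow> I \<cdot> U \<in> sections E" "U \<in> sections E \<Longrightarrow> J \<cdot> U \<in> sections E"
  "U \<in> sections E \<Longrightarrow> K \<cdot> U \<in> sections E"
  using sections_endo[OF vbundle] endos by blast+

sublocale sec: quaternionic "sections E" "endo_app I" "endo_app J" "endo_app K"
proof
  fix U assume "U \<in> sections E" "U + U = 0"
  then show "U = 0" by (simp add: fun_eq_iff flip: scaleR_2)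
qed (simp_all add: endo_sections(1,2)[unfolded endo_app_def] endo_app_def fun_eq_iff fib.linear_simps)

lemma pairing_skew:
  assumes "u \<in> fibre E p" "v \<in> fibre E p"
  shows "pairing E p (I p u) v = - pairing E p u (I p v)"
    "pairing E p (J p u) v = - pairing E p u (J p v)"
    "pairing E p (K p u) v = - pairing E p u (K p v)"
proof -
  have orth: "pairing E p (F p a) (F p b) = pairing E p a b"
    if "almost_complex E F" "a \<in> fibre E p" "b \<in> fibre E p" for F a b
    using that unfolding almost_complex_def by blast
  show "pairing E p (I p u) v = - pairing E p u (I p v)"
    "pairing E p (J p u) v = - pairing E p u (J p v)"
    "pairing E p (K p u) v = - pairing E p u (K p v)"
    using orth[OF complex_structures(1), of "I p u" v] orth[OF complex_structures(2), of "J p u" v]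
      orth[OF complex_structures(3), of "K p u" v] assms
    by simp_all
qed

lemma pair_skew:
  assumes "U \<in> sections E" "V \<in> sections E"
  shows "pair E (I \<cdot> U) V = - pair E U (I \<cdot> V)"
    "pair E (J \<cdot> U) V = - pair E U (J \<cdot> V)"
    "pair E (K \<cdot> U) V = - pair E U (K \<cdot> V)"
  using assms by (simp_all add: pair_def endo_app_def pairing_skew fun_eq_iff)

section \<open>The skew bracket of an almost hypercomplex structure\<close>

text \<open>
  The sum \<open>\<Omega>(U, V)\<close> of \<open>a\<^sup>-\<^sup>1 \<D>\<langle>U, aV\<rangle>\<close> over \<open>a \<in> {1, I, J, K}\<close>.
\<close>

definition quat_sym :: "('m \<Rightarrow> 'v) \<Rightarrow> ('m \<Rightarrow> 'v) \<Rightarrow> 'm \<Rightarrow> 'v" where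
  "quat_sym U V = calD E (pair E U V) - I \<cdot> calD E (pair E U (I \<cdot> V))
     - J \<cdot> calD E (pair E U (J \<cdot> V)) - K \<cdot> calD E (pair E U (K \<cdot> V))"

lemma quat_sym_sections [simp]: "U \<in> sections E \<Longrightarrow> V \<in> sections E \<Longrightarrow> quat_sym U V \<in> sections E"
  by (simp add: quat_sym_def)

text \<open>
  The summands of \<open>\<Omega>(U, bV)\<close> are \<open>a\<^sup>-\<^sup>1 \<D>\<langle>U, abV\<rangle> = b c\<^sup>-\<^sup>1 \<D>\<langle>U, cV\<rangle>\<close> with \<open>c = ab\<close>. They do not depend on
  the sign of \<open>c\<close>, and up to sign \<open>c\<close> runs through \<open>{1, I, J, K}\<close> as \<open>a\<close> does.
\<close>

lemma quat_sym_equivariant: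
  assumes "U \<in> sections E" "V \<in> sections E"
  shows "quat_sym U (I \<cdot> V) = I \<cdot> quat_sym U V"
    "quat_sym U (J \<cdot> V) = J \<cdot> quat_sym U V"
    "quat_sym U (K \<cdot> V) = K \<cdot> quat_sym U V"
  using assms by (simp_all add: quat_sym_def pair_minus calD_minus sec.linear_simps algebra_simps)

definition bracket :: "('m \<Rightarrow> 'v) \<Rightarrow> ('m \<Rightarrow> 'v) \<Rightarrow> 'm \<Rightarrow> 'v" where
  "bracket U V = dorfman E U V - quat_sym U V"

text \<open>
  In \<open>\<Omega>(U, V) + \<Omega>(V, U)\<close> the terms of \<open>I\<close>, \<open>J\<close>, \<open>K\<close> cancel, because \<open>\<langle>V, IU\<rangle> = - \<langle>U, IV\<rangle>\<close>, and
  \<open>2 \<D>\<langle>U, V\<rangle> = U \<circ> V + V \<circ> U\<close> remains.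
\<close>

lemma bracket_skew:
  assumes "U \<in> sections E" "V \<in> sections E"
  shows "bracket V U = - bracket U V"
proof -
  have "quat_sym U V + quat_sym V U = dorfman E U V + dorfman E V U"
    using assms pair_skew[of V U] pair_sym[of U V]
      pair_sym[of "I \<cdot> V" U] pair_sym[of "J \<cdot> V" U] pair_sym[of "K \<cdot> V" U]
    by (simp add: dorfman_sym quat_sym_def calD_minus sec.linear_simps)
  then show ?thesis by (simp add: bracket_def algebra_simps)
qed

sublocale sec: quaternionic_bracket "sections E" "endo_app I" "endo_app J" "endo_app K" bracket
proof
  fix U V W assume "U \<in> sections E" "V \<in> sections E" "W \<in> sections E"
  then show "bracket U (V + W) = bracket U V + bracket U W"
    by (simp add: bracket_def quat_sym_def dorfman_add_right pair_add calD_add sec.linear_simps)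
next
  fix U V assume UV: "U \<in> sections E" "V \<in> sections E"
  then show "bracket U V \<in> sections E" by (simp add: bracket_def)
  show "bracket V U = - bracket U V" using UV by (rule bracket_skew)
qed

lemma nijenhuis_zero_iff_bracket:
  assumes "F \<in> {I, J, K}" "G \<in> {I, J, K}"
  shows "nijenhuis_zero E F G \<longleftrightarrow> nij_zero (sections E) bracket (endo_app F) (endo_app G)"
proof -
  have "nij_zero (sections E) (\<lambda>U V. dorfman E U V - quat_sym U V) (endo_app F) (endo_app G) \<longleftrightarrow>
      nij_zero (sections E) (dorfman E) (endo_app F) (endo_app G)"
    by (rule sec.nij_zero_subtract_equivariant)
      (use assms in \<open>auto simp: sec.linear_simps quat_sym_equivariant\<close>)
  then show ?thesis
    by (simp add: bracket_def[abs_def] nijenhuis_zero_def nij_zero_def nijenhuis_def nij_def)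
qed

lemma triangle_fibre [simp]:
  "f \<in> Cinf E \<Longrightarrow> triangle E I J K f U V p \<in> fibre E p"
  by (simp add: triangle_def fscale_def endo_app_def)

text \<open>
  The same reindexing as for \<open>\<Omega>\<close>, now with \<open>\<langle>aU, V\<rangle> = - \<langle>U, aV\<rangle>\<close> for \<open>a \<in> {I, J, K}\<close>.
\<close>

lemma triangle_equivariant:
  assumes "f \<in> Cinf E" "U \<in> sections E" "V \<in> sections E"
  shows "triangle E I J K f U (I \<cdot> V) p = I p (triangle E I J K f U V p)"
    "triangle E I J K f U (J \<cdot> V) p = J p (triangle E I J K f U V p)"
  using assms
  by (simp_all add: triangle_def pair_skew pair_minus fib.linear_simps endo_scale fscale_def
      endo_app_def[of _ "calD E f"])

section \<open>The Obata connection\<close>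

lemma endo_fscale:
  assumes "U \<in> sections E"
  shows "I \<cdot> (f \<star> U) = f \<star> (I \<cdot> U)" "J \<cdot> (f \<star> U) = f \<star> (J \<cdot> U)" "K \<cdot> (f \<star> U) = f \<star> (K \<cdot> U)"
  using assms by (simp_all add: endo_app_def fscale_def endo_scale)

text \<open>
  The defect of function-linearity of \<open>\<Omega>\<close> is exactly the term \<open>\<triangle>\<close> in the Leibniz rule of hypercomplex
  connections: the product rule for \<open>\<D>\<close> produces \<open>\<langle>U, aV\<rangle> a\<^sup>-\<^sup>1 \<D>f = \<langle>aU, V\<rangle> a \<D>f\<close> for \<open>a \<in> {I, J, K}\<close>.
\<close>

lemma quat_sym_fscale:
  assumes "f \<in> Cinf E" "U \<in> sections E" "V \<in> sections E"
  shows "quat_sym U (f \<star> V) p = f p *\<^sub>R quat_sym U V p + triangle E I J K f U V p"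
proof -
  have D: "calD E (pair E U (f \<star> W)) p = f p *\<^sub>R calD E (pair E U W) p + pair E U W p *\<^sub>R calD E f p"
    if "W \<in> sections E" for W
    using that assms by (simp add: pair_fscale calD_mult) (simp add: fscale_def)
  show ?thesis
    using assms
    by (simp add: quat_sym_def endo_fscale D endo_app_def[of _ "calD E _"])
      (simp add: triangle_def pair_skew fscale_def endo_scale endo_app_def[of _ "calD E _"]
        fib.linear_simps scaleR_right_diff_distrib algebra_simps)
qed

lemma bracket_leibniz_right:
  assumes "f \<in> Cinf E" "U \<in> sections E" "V \<in> sections E"
  shows "bracket U (f \<star> V) p =
    lie E U f p *\<^sub>R V p + f p *\<^sub>R bracket U V p - triangle E I J K f U V p"
  using assms by (simp add: bracket_def dorfman_leibniz quat_sym_fscale) (simp add: fscale_def algebra_simps)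

lemma bracket_leibniz_left:
  assumes "f \<in> Cinf E" "U \<in> sections E" "V \<in> sections E"
  shows "bracket (f \<star> U) V p =
    f p *\<^sub>R bracket U V p - lie E V f p *\<^sub>R U p + triangle E I J K f V U p"
  using bracket_leibniz_right[OF assms(1,3,2), of p] bracket_skew[of V "f \<star> U"] bracket_skew[of V U] assms
  by (simp add: algebra_simps)

text \<open>
  The derivatives of \<open>f\<close> along \<open>U\<close> and the terms \<open>\<triangle>\<close> for \<open>U\<close> come from the first and the last summand
  of \<open>obata\<close>; those for \<open>IU\<close> come from the other two and cancel because \<open>KJ = - I\<close>.
\<close>

lemma obata_leibniz_right:
  assumes "f \<in> Cinf E" "U \<in> sections E" "V \<in> sections E"
  shows "sec.obata U (f \<star> V) p =
    f p *\<^sub>R sec.obata U V p + (lie E U f p *\<^sub>R V p - triangle E I J K f U V p)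
      + (lie E U f p *\<^sub>R V p - triangle E I J K f U V p)"
proof -
  have app: "(F \<cdot> W) p = F p (W p)" for F and W :: "'m \<Rightarrow> 'v" by (simp add: endo_app_def)
  show ?thesis
    using assms
    by (simp add: sec.obata_def app endo_fscale bracket_leibniz_right triangle_equivariant
        fib.linear_simps endo_scale algebra_simps)
qed

text \<open>
  Everything but the first term cancels. Once \<open>I\<close> is pulled out of the second argument of \<open>\<triangle>\<close>, the
  summands of \<open>obata\<close> contribute \<open>\<triangle>(V, U)\<close>, \<open>J \<triangle>(JV, U)\<close>, \<open>- \<triangle>(V, U)\<close> and \<open>- J \<triangle>(JV, U)\<close>; here the second
  uses \<open>KI = J\<close>. The derivatives of \<open>f\<close> along \<open>V\<close> and \<open>JV\<close> cancel in the same pairs.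
\<close>

lemma obata_leibniz_left:
  assumes "f \<in> Cinf E" "U \<in> sections E" "V \<in> sections E"
  shows "sec.obata (f \<star> U) V p = f p *\<^sub>R sec.obata U V p"
proof -
  have app: "(F \<cdot> W) p = F p (W p)" for F and W :: "'m \<Rightarrow> 'v" by (simp add: endo_app_def)
  show ?thesis
    using assms
    by (simp add: sec.obata_def app endo_fscale bracket_leibniz_left triangle_equivariant
        fib.linear_simps endo_scale algebra_simps)
qed

lemma obata_add:
  assumes "U \<in> sections E" "V \<in> sections E" "W \<in> sections E"
  shows "sec.obata (U + V) W = sec.obata U W + sec.obata V W"
    "sec.obata U (V + W) = sec.obata U V + sec.obata U W"
  using assms
  by (simp_all add: sec.obata_def sec.linear_simps sec.C_add_left sec.C_add_right algebra_simps)

definition obata_connection :: "('m \<Rightarrow> 'v) \<Rightarrow> ('m \<Rightarrow> 'v) \<Rightarrow> 'm \<Rightarrow> 'v" where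
  "obata_connection =
     (\<lambda>U\<in>sections E. \<lambda>V\<in>sections E. (\<lambda>_. 1/2) \<star> sec.obata U V)"

lemma obata_connection_apply [simp]:
  "\<lbrakk>U \<in> sections E; V \<in> sections E\<rbrakk> \<Longrightarrow> obata_connection U V = (\<lambda>_. 1/2) \<star> sec.obata U V"
  by (simp add: obata_connection_def)

lemma lie_const: "U \<in> sections E \<Longrightarrow> lie E U (\<lambda>_. c) p = 0"
  by (simp add: lie_def anchor_const)

lemma triangle_const: "triangle E I J K (\<lambda>_. c) U V p = 0"
proof -
  have "0 \<in> fibre E p" using subspace_0[OF fib_subspace] .
  then show ?thesis
    using endo_scale[of 0 p 0] by (simp add: triangle_def calD_const endo_app_def fscale_def)
qed

lemma hypercomplex_connection_obata: "hypercomplex_connection E I J K obata_connection"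
  unfolding hypercomplex_connection_def bilinear_on_sections_def
proof (intro conjI ballI allI)
  show "obata_connection \<in> sections E \<rightarrow>\<^sub>E sections E \<rightarrow>\<^sub>E sections E"
    by (auto simp: obata_connection_def)
next
  fix U V assume UV: "U \<in> sections E" "V \<in> sections E"
  then show "obata_connection U V \<in> sections E" by simp
  have leib: "obata_connection (f \<star> U) V = f \<star> obata_connection U V"
    "obata_connection U (f \<star> V) =
      lie E U f \<star> V + f \<star> obata_connection U V - triangle E I J K f U V"
    if "f \<in> Cinf E" for f
  proof -
    have half: "(1/2) *\<^sub>R (x + y + y) = (1/2) *\<^sub>R x + y" for x y :: 'v
      by (simp add: scaleR_right_distrib flip: scaleR_left_distrib)
    show "obata_connection (f \<star> U) V = f \<star> obata_connection U V"
      using UV that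
      by (simp add: fun_eq_iff fscale_def[of "\<lambda>_. 1/2"] obata_leibniz_left) (simp add: fscale_def)
    show "obata_connection U (f \<star> V) =
        lie E U f \<star> V + f \<star> obata_connection U V - triangle E I J K f U V"
      using UV that
      by (simp add: fun_eq_iff fscale_def[of "\<lambda>_. 1/2"] obata_leibniz_right half)
        (simp add: fscale_def)
  qed
  show "obata_connection ((\<lambda>p. c) \<star> U) V = (\<lambda>p. c) \<star> obata_connection U V" for c
    by (rule leib) simp
  show "obata_connection U ((\<lambda>p. c) \<star> V) = (\<lambda>p. c) \<star> obata_connection U V" for c
    using UV leib(2)[of "\<lambda>_. c"] by (simp add: fun_eq_iff lie_const triangle_const fscale_def)
  show "obata_connection (f \<star> U) V = f \<star> obata_connection U V"
    "obata_connection U (f \<star> V) =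
      lie E U f \<star> V + f \<star> obata_connection U V - triangle E I J K f U V"
    if "f \<in> Cinf E" for f
    using leib[OF that] .
next
  fix U V W assume "U \<in> sections E" "V \<in> sections E" "W \<in> sections E"
  then show "obata_connection (U + V) W = obata_connection U W + obata_connection V W"
    "obata_connection U (V + W) = obata_connection U V + obata_connection U W"
    by (simp_all add: obata_add fscale_def fun_eq_iff scaleR_right_distrib)
qed

lemma half_double: "(\<lambda>_. 1/2) \<star> (X + X) = (X :: 'm \<Rightarrow> 'v)"
  by (simp add: fscale_def fun_eq_iff flip: scaleR_2)

text \<open>
  The skew part of the Dorfman bracket is \<open>U \<circ> V - \<D>\<langle>U, V\<rangle>\<close>; adding the prescribed torsion to it gives
  the skew bracket \<open>C\<close>.
\<close>

lemma torsion_condition_iff: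
  assumes "U \<in> sections E" "V \<in> sections E"
  shows "torsion E D U V =
      I \<cdot> calD E (pair E U (I \<cdot> V)) + J \<cdot> calD E (pair E U (J \<cdot> V)) + K \<cdot> calD E (pair E U (K \<cdot> V)) \<longleftrightarrow>
    D U V - D V U = bracket U V"
proof -
  have "dorfman E V U = calD E (pair E U V) + calD E (pair E U V) - dorfman E U V"
    using dorfman_sym[OF assms] by (simp add: algebra_simps)
  then have "dorfman E U V - dorfman E V U =
      (dorfman E U V - calD E (pair E U V)) + (dorfman E U V - calD E (pair E U V))"
    by simp
  then have "(\<lambda>p. 1/2) \<star> (dorfman E U V - dorfman E V U) = dorfman E U V - calD E (pair E U V)"
    by (simp only: half_double)
  then have "torsion E D U V = (D U V - D V U) - (dorfman E U V - calD E (pair E U V))"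
    by (simp only: torsion_def)
  moreover have "bracket U V =
      (I \<cdot> calD E (pair E U (I \<cdot> V)) + J \<cdot> calD E (pair E U (J \<cdot> V)) + K \<cdot> calD E (pair E U (K \<cdot> V)))
      + (dorfman E U V - calD E (pair E U V))"
    by (simp add: bracket_def quat_sym_def algebra_simps)
  ultimately show ?thesis by (simp only: diff_eq_eq)
qed

lemma parallel_obata:
  assumes "nij_zero (sections E) bracket (endo_app I) (endo_app I)" "F \<in> {I, J, K}"
  shows "parallel E obata_connection F"
  unfolding parallel_def
  using assms sec.obata_I[OF assms(1)] sec.obata_J sec.obata_K[OF assms(1)]
  by (auto simp: endo_fscale)

section \<open>Existence and uniqueness of the connection\<close>

text \<open>
  The conditions that characterise the connection, with the torsion condition in the form
  provided by \<open>torsion_condition_iff\<close>.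
\<close>

definition obata_conditions :: "(('m \<Rightarrow> 'v) \<Rightarrow> ('m \<Rightarrow> 'v) \<Rightarrow> 'm \<Rightarrow> 'v) \<Rightarrow> bool" where
  "obata_conditions D \<longleftrightarrow> hypercomplex_connection E I J K D \<and>
     parallel E D I \<and> parallel E D J \<and> parallel E D K \<and>
     (\<forall>U\<in>sections E. \<forall>V\<in>sections E. D U V - D V U = bracket U V)"

lemma obata_conditions_obata:
  assumes "nij_zero (sections E) bracket (endo_app I) (endo_app J)"
  shows "obata_conditions obata_connection"
proof -
  have "obata_connection U V - obata_connection V U = bracket U V"
    if UV: "U \<in> sections E" "V \<in> sections E" for U V
  proof -
    have "sec.obata U V - sec.obata V U = bracket U V + bracket U V"
      using sec.obata_torsion[OF UV] assms UV sec.zero_image[OF UV(1)] by (simp add: nij_zero_def)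
    then have "(\<lambda>_. 1/2) \<star> (sec.obata U V - sec.obata V U) = bracket U V"
      by (simp only: half_double)
    then show ?thesis using UV by (simp add: fscale_def fun_eq_iff scaleR_right_diff_distrib)
  qed
  then show ?thesis
    using hypercomplex_connection_obata parallel_obata[OF sec.nij_IJ_imp_II_JJ(1)[OF assms]]
    by (simp add: obata_conditions_def)
qed

lemma nij_zero_of_obata_conditions:
  assumes "obata_conditions D"
  shows "nij_zero (sections E) bracket (endo_app I) (endo_app J)"
proof (rule sec.nij_zero_of_equivariant[where W = "\<lambda>U V. D U V + D U V"])
  have D: "D U V \<in> sections E" if "U \<in> sections E" "V \<in> sections E" for U V
    using assms that by (auto simp: obata_conditions_def hypercomplex_connection_def bilinear_on_sections_def)
  show "D U V + D U V \<in> sections E" if "U \<in> sections E" "V \<in> sections E" for U V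
    using D that by simp
  fix U V assume UV: "U \<in> sections E" "V \<in> sections E"
  have "bracket U V = D U V - D V U" using assms UV by (simp add: obata_conditions_def)
  then show "D U V + D U V - (D V U + D V U) = bracket U V + bracket U V"
    by simp
  show "D U (I \<cdot> V) + D U (I \<cdot> V) = I \<cdot> (D U V + D U V)"
    "D U (J \<cdot> V) + D U (J \<cdot> V) = J \<cdot> (D U V + D U V)"
    using assms UV D by (simp_all add: obata_conditions_def parallel_def sec.linear_simps)
qed (simp_all add: sec.linear_simps)

text \<open>
  The difference of two solutions is symmetric, as both have the same alternation, and commutes with \<open>I\<close>
  and \<open>J\<close> in the second argument. By symmetry it does so in the first, and vanishes.
\<close>

lemma obata_conditions_unique:
  assumes D: "obata_conditions D" and D': "obata_conditions D'"
  shows "D = D'"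
proof -
  have closed: "D U V \<in> sections E" "D' U V \<in> sections E" if "U \<in> sections E" "V \<in> sections E" for U V
    using D D' that by (auto simp: obata_conditions_def hypercomplex_connection_def bilinear_on_sections_def)
  define T where "T U V = D U V - D' U V" for U V
  have sym: "T V U = T U V" if "U \<in> sections E" "V \<in> sections E" for U V
  proof -
    have "D U V - D V U = D' U V - D' V U"
      using D D' that by (simp add: obata_conditions_def)
    then show ?thesis unfolding T_def by (simp add: algebra_simps)
  qed
  have right: "T U (I \<cdot> V) = I \<cdot> T U V" "T U (J \<cdot> V) = J \<cdot> T U V"
    if "U \<in> sections E" "V \<in> sections E" for U V
    using D D' that closed by (simp_all add: T_def obata_conditions_def parallel_def sec.linear_simps)
  have T0: "T U V = 0" if "U \<in> sections E" "V \<in> sections E" for U V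
  proof (rule sec.biequivariant_zero[where T = T])
    fix U V assume UV: "U \<in> sections E" "V \<in> sections E"
    show "T U V \<in> sections E" using closed[OF UV] by (simp add: T_def)
    show "T (I \<cdot> U) V = I \<cdot> T U V"
      unfolding sym[OF UV(2) endo_sections(1)[OF UV(1)]] right(1)[OF UV(2,1)] sym[OF UV] ..
    show "T (J \<cdot> U) V = J \<cdot> T U V"
      unfolding sym[OF UV(2) endo_sections(2)[OF UV(1)]] right(2)[OF UV(2,1)] sym[OF UV] ..
  qed (use right that in simp_all)
  have PiE: "D \<in> sections E \<rightarrow>\<^sub>E sections E \<rightarrow>\<^sub>E sections E" "D' \<in> sections E \<rightarrow>\<^sub>E sections E \<rightarrow>\<^sub>E sections E"
    using D D' by (simp_all add: obata_conditions_def hypercomplex_connection_def)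
  show "D = D'"
  proof (rule PiE_ext[OF PiE])
    fix U assume U: "U \<in> sections E"
    show "D U = D' U"
      by (rule PiE_ext[OF PiE_mem[OF PiE(1) U] PiE_mem[OF PiE(2) U]])
        (use T0[OF U] in \<open>simp add: T_def\<close>)
  qed
qed

end

theorem theorem3p14:
  fixes E :: "('m::{t2_space,second_countable_topology}, 'v::real_vector) courant_data"
    and I J K :: "'m \<Rightarrow> 'v \<Rightarrow> 'v"
  assumes "courant_algebroid E"
    and "almost_hypercomplex E I J K"
  shows "(nijenhuis_zero E I J \<longleftrightarrow> nijenhuis_zero E I I \<and> nijenhuis_zero E J J) \<and>
    (nijenhuis_zero E I I \<and> nijenhuis_zero E J J \<longleftrightarrow> hypercomplex E I J K) \<and>
    (hypercomplex E I J K \<longleftrightarrow>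
      (\<exists>!D. hypercomplex_connection E I J K D \<and>
        parallel E D I \<and> parallel E D J \<and> parallel E D K \<and>
        (\<forall>U\<in>sections E. \<forall>V\<in>sections E.
           torsion E D U V =
             I \<cdot> calD E (pair E U (I \<cdot> V)) + J \<cdot> calD E (pair E U (J \<cdot> V))
             + K \<cdot> calD E (pair E U (K \<cdot> V)))))"
proof -
  interpret almost_hypercomplex_courant E I J K
    by (unfold_locales; fact)
  let ?N = "\<lambda>F G. nij_zero (sections E) bracket (endo_app F) (endo_app G)"
  have iff12: "?N I J \<longleftrightarrow> ?N I I \<and> ?N J J"
    using sec.nij_IJ_imp_II_JJ sec.nij_IJ_of_II_JJ by blast
  have all: "?N F G" if "?N I J" "F \<in> {I, J, K}" "G \<in> {I, J, K}" for F G
    by (rule sec.nij_zero_all) (use that in auto)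
  have iff13: "hypercomplex E I J K \<longleftrightarrow> ?N I J"
    using all assms(2) by (auto simp: hypercomplex_def nijenhuis_zero_iff_bracket)
  have iff14: "?N I J \<longleftrightarrow> (\<exists>!D. obata_conditions D)"
    using obata_conditions_obata nij_zero_of_obata_conditions obata_conditions_unique by blast
  show ?thesis
    using iff12 iff13 iff14
    by (simp add: nijenhuis_zero_iff_bracket obata_conditions_def torsion_condition_iff)
qed

end
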